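(* For all $\pi_p$-processes $P$ and $Q$ (not containing the testing name $\omega$): (1) if $P\sqsubseteq_S Q$ then $P\sqsubseteq_{pmay}Q$; (2) if $P\sqsubseteq_{FS}Q$ then $P\sqsubseteq_{pmust}Q$.
   Context: Fix a countably infinite set of names $a,b,x,y,\dots$; $\bar a$ is the co-name of $a$, and $\mu$ ranges over names and co-names. Processes of the probabilistic $\pi$-calculus $\pi_p$ are given by $P ::= s \mid P\oplus_p P$ with $p\in(0,1]$, and state-based processes by $s ::= 0 \mid a(x).P \mid \bar a x.P \mid [x=y]s \mid [x\neq y]s \mid s+s \mid s\,|\,s \mid \nu x.s$; $a(x)$ and $\nu x$ bind $x$, terms are identified up to $\alpha$-conversion, and $fn,bn,n$ denote free, bound and all names. $S_p$ is the set of state-based processes. A distribution $\Delta$ is a finitely supported probability distribution on $S_p$; $\mathrm{supp}\,\Delta=\{s\mid\Delta(s)>0\}$, $\overline{s}$ is the point distribution at $s$, $fn(\Delta)=\bigcup_{s\in\mathrm{supp}\,\Delta}fn(s)$, and $\sum_i p_i\cdot\Delta_i$ denotes a convex combination. Interpretation: $[\![s]\!]=\overline s$, $[\![P\oplus_pQ]\!]=p\cdot[\![P]\!]+(1-p)\cdot[\![Q]\!]$; also $[\![P|Q]\!]=[\![P]\!]|[\![Q]\!]$ and $[\![\nu x.P]\!]=\nu x.[\![P]\!]$, where on distributions $(\Delta_1|\Delta_2)(s_1|s_2)=\Delta_1(s_1)\Delta_2(s_2)$ (0 on states not of this form), $(\nu x.\Delta)(\nu x.s)=\Delta(s)$ (0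 elsewhere), and $\Delta[y/x](s)=\sum\{\Delta(s')\mid s'[y/x]=s\}$. Actions: $\tau$, bound input $a(x)$, free output $\bar ax$, bound output $\bar a(x)$. The late transition relation $s\xrightarrow{\alpha}\Delta$ is the least relation such that: $a(x).P\xrightarrow{a(x)}[\![P]\!]$, $\bar ax.P\xrightarrow{\bar ax}[\![P]\!]$; if $s\xrightarrow{\alpha}\Delta$ then $s+t\xrightarrow{\alpha}\Delta$, $t+s\xrightarrow{\alpha}\Delta$, $[x=x]s\xrightarrow{\alpha}\Delta$, and $[x\ne y]s\xrightarrow{\alpha}\Delta$ if $x\neq y$; if $s\xrightarrow{\alpha}\Delta$ and $bn(\alpha)\cap fn(t)=\emptyset$ then $s|t\xrightarrow{\alpha}\Delta|\overline t$ and $t|s\xrightarrow{\alpha}\overline t|\Delta$; if $s\xrightarrow{a(x)}\Delta_1$ and $t\xrightarrow{\bar ay}\Delta_2$ then $s|t\xrightarrow{\tau}\Delta_1[y/x]|\Delta_2$ and $t|s\xrightarrow{\tau}\Delta_2|\Delta_1[y/x]$; if $s\xrightarrow{a(w)}\Delta_1$ and $t\xrightarrow{\bar a(w)}\Delta_2$ then $s|t\xrightarrow{\tau}\nu w.(\Delta_1|\Delta_2)$ and $t|s\xrightarrow{\tau}\nu w.(\Delta_2|\Delta_1)$; if $s\xrightarrow{\alpha}\Delta$ and $x\notin n(\alpha)$ then $\nu x.s\xrightarrow{\alpha}\nu x.\Delta$; if $s\xrightarrow{\bar xz}\Delta$, $y\ne x$, $y\notin fn(\nu z.s)$ then $\nu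 z.s\xrightarrow{\bar x(y)}\Delta[y/z]$. Lifting: for $\mathcal R\subseteq S_p\times\mathcal D(S_p)$, $\overline{\mathcal R}$ is the smallest relation on distributions with $\overline s\,\overline{\mathcal R}\,\Theta$ whenever $s\mathcal R\Theta$, and $(\sum_{i\in I}p_i\Delta_i)\overline{\mathcal R}(\sum_{i\in I}p_i\Theta_i)$ whenever $\Delta_i\overline{\mathcal R}\Theta_i$ for all $i$ in a finite $I$, $\sum p_i=1$. $\Delta\xrightarrow{\alpha}\Theta$ denotes the lifted transition (bound names chosen in common). $s\xrightarrow{\hat\tau}\Delta$ means $s\xrightarrow{\tau}\Delta$ or $\Delta=\overline s$; $\xRightarrow{\hat\tau}$ is the reflexive-transitive closure of its lifting; for $\alpha\ne\tau$, $\Delta\xRightarrow{\hat\alpha}\Delta'$ iff $\Delta\xRightarrow{\hat\tau}\Delta_1\xrightarrow{\alpha}\Delta_2\xRightarrow{\hat\tau}\Delta'$. $s\Downarrow a$ iff $s\xrightarrow{a(x)}\Delta$ for some $x,\Delta$; $s\Downarrow\bar a$ iff $s\xrightarrow{\bar a(x)}\Delta$ or $s\xrightarrow{\bar ax}\Delta$ for some $x,\Delta$. For a set $X$ of names/co-names, $s\not\Downarrow X$ means $s$ has no $\tau$-transition and no $\mu\in X$ has $s\Downarrow\mu$; $\Delta\not\Downarrow X$ means $s\not\Downarrow X$ for all $s\in\mathrm{supp}\,\Delta$. A relation $\mathcal R\subseteq S_p\times\mathcal D(S_p)$ is a failure simulation if $s\mathcal R\Theta$ implies: (1) if $s\xrightarrow{a(x)}\Delta$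 with $x\notin fn(s,\Theta)$, then for every name $w$ there are $\Theta_1,\Theta_2,\Theta'$ with $\Theta\xRightarrow{\hat\tau}\Theta_1\xrightarrow{a(x)}\Theta_2$, $\Theta_2[w/x]\xRightarrow{\hat\tau}\Theta'$ and $\Delta[w/x]\overline{\mathcal R}\Theta'$; (2) if $s\xrightarrow{\alpha}\Delta$, $\alpha$ not an input action, then $\Theta\xRightarrow{\hat\alpha}\Theta'$ and $\Delta\overline{\mathcal R}\Theta'$ for some $\Theta'$; (3) if $s\not\Downarrow X$ then $\Theta\xRightarrow{\hat\tau}\Theta'\not\Downarrow X$ for some $\Theta'$. A simulation satisfies (1),(2). $\triangleleft_S$, $\triangleleft_{FS}$ are the largest simulation and failure simulation. $P\sqsubseteq_SQ$ iff $[\![Q]\!]\xRightarrow{\hat\tau}\Theta$ and $[\![P]\!]\overline{\triangleleft_S}\Theta$ for some $\Theta$; $P\sqsubseteq_{FS}Q$ iff $[\![P]\!]\xRightarrow{\hat\tau}\Theta$ and $[\![Q]\!]\overline{\triangleleft_{FS}}\Theta$ for some $\Theta$. Testing: $\omega$ is a distinguished name not occurring in tested processes; a test is a $\pi_p$-process possibly also containing output prefixes on channel $\omega$; $s\xrightarrow{\omega}$ means $s\xrightarrow{\bar\omega b}\Delta$ for some $b,\Delta$. $\mathbb V(s)=\{1\}$ if $s\xrightarrow{\omega}$; $\mathbb V(s)=\bigcup\{\mathbb V(\Delta)\mid s\xrightarrow{\tau}\Delta\}$ if not $s\xrightarrow{\omega}$ but $s$ has a $\tau$-transition; $\mathbb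 V(s)=\{0\}$ otherwise; $\mathbb V(\Delta)=\{\sum_{s\in\mathrm{supp}\,\Delta}\Delta(s)p_s\mid p_s\in\mathbb V(s)\}$. $Apply(T,P)=\mathbb V([\![\nu\vec x.(T|P)]\!])$ with $\vec x$ enumerating $fn(T,P)\setminus\{\omega\}$. For $O_1,O_2\subseteq[0,1]$: $O_1\sqsubseteq_{Ho}O_2$ iff each $o_1\in O_1$ has $o_2\in O_2$ with $o_1\le o_2$; $O_1\sqsubseteq_{Sm}O_2$ iff each $o_2\in O_2$ has $o_1\in O_1$ with $o_1\le o_2$. $P\sqsubseteq_{pmay}Q$ iff $Apply(T,P)\sqsubseteq_{Ho}Apply(T,Q)$ for all tests $T$; $P\sqsubseteq_{pmust}Q$ iff $Apply(T,P)\sqsubseteq_{Sm}Apply(T,Q)$ for all tests $T$. *)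

theory Defs
  imports "HOL-Probability.Probability"
begin

section \<open>Syntax\<close>

type_synonym name = nat

typedef prob = "{p::real. 0 < p \<and> p \<le> 1}" morphisms real_of_prob prob_of_real
  by (rule exI[of _ 1]) simp

text \<open>
  Terms up to \<alpha>-conversion are represented by de Bruijn terms in which free names are indices
  too: under \<open>n\<close> binders, an index \<open>i < n\<close> refers to the \<open>i\<close>-th enclosing binder and
  \<open>n + k\<close> to the free name \<open>k\<close>. Every element of these datatypes is thus
  exactly one \<alpha>-equivalence class. The binders \<open>a(x).P\<close> and \<open>\<nu>x.s\<close> with named
  \<open>x\<close> are the functions \<open>inp\<close> and \<open>nu\<close> below; the raw binding constructors
  \<open>DInp\<close> and \<open>DRes\<close> occur only in the recursive definitions on terms.
\<close>

datatype state =
    Zero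
  | DInp name "proc"
  | Outp name name "proc"
  | Match name name state
  | Mismatch name name state
  | Sum state state
  | Par state state
  | DRes state
and proc =
    St state
  | Choice "proc" prob "proc"

definition up :: "(name \<Rightarrow> name) \<Rightarrow> name \<Rightarrow> name" where
  "up f k = (case k of 0 \<Rightarrow> 0 | Suc j \<Rightarrow> Suc (f j))"

primrec ren :: "(name \<Rightarrow> name) \<Rightarrow> state \<Rightarrow> state"
  and renp :: "(name \<Rightarrow> name) \<Rightarrow> proc \<Rightarrow> proc" where
  "ren f Zero = Zero"
| "ren f (DInp a P) = DInp (f a) (renp (up f) P)"
| "ren f (Outp a x P) = Outp (f a) (f x) (renp f P)"
| "ren f (Match x y s) = Match (f x) (f y) (ren f s)"
| "ren f (Mismatch x y s) = Mismatch (f x) (f y) (ren f s)"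
| "ren f (Sum s t) = Sum (ren f s) (ren f t)"
| "ren f (Par s t) = Par (ren f s) (ren f t)"
| "ren f (DRes s) = DRes (ren (up f) s)"
| "renp f (St s) = St (ren f s)"
| "renp f (Choice P p Q) = Choice (renp f P) p (renp f Q)"

primrec fn :: "state \<Rightarrow> name set" and fnp :: "proc \<Rightarrow> name set" where
  "fn Zero = {}"
| "fn (DInp a P) = insert a {k. Suc k \<in> fnp P}"
| "fn (Outp a x P) = {a, x} \<union> fnp P"
| "fn (Match x y s) = {x, y} \<union> fn s"
| "fn (Mismatch x y s) = {x, y} \<union> fn s"
| "fn (Sum s t) = fn s \<union> fn t"
| "fn (Par s t) = fn s \<union> fn t"
| "fn (DRes s) = {k. Suc k \<in> fn s}"
| "fnp (St s) = fn s"
| "fnp (Choice P p Q) = fnp P \<union> fnp Q"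

definition bnd :: "name \<Rightarrow> name \<Rightarrow> name" where
  "bnd x k = (if k = x then 0 else Suc k)"

definition inp :: "name \<Rightarrow> name \<Rightarrow> proc \<Rightarrow> state" where
  "inp a x P = DInp a (renp (bnd x) P)"

definition nu :: "name \<Rightarrow> state \<Rightarrow> state" where
  "nu x s = DRes (ren (bnd x) s)"

text \<open>\<open>subst s y x\<close> is \<open>s[y/x]\<close>; it is capture-avoiding because \<open>ren\<close> shifts under binders.\<close>

definition subst :: "state \<Rightarrow> name \<Rightarrow> name \<Rightarrow> state" where
  "subst s y x = ren (id(x := y)) s"

definition substp :: "proc \<Rightarrow> name \<Rightarrow> name \<Rightarrow> proc" where
  "substp P y x = renp (id(x := y)) P"

subsection \<open>The representation behaves as named syntax up to \<alpha>-conversion\<close>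

lemma up_simps [simp]: "up f 0 = 0" "up f (Suc k) = Suc (f k)"
  by (simp_all add: up_def)

lemma up_comp: "up f \<circ> up g = up (f \<circ> g)"
  by (auto simp: fun_eq_iff up_def split: nat.splits)

lemma finite_Suc_vimage: "finite A \<Longrightarrow> finite {k. Suc k \<in> A}"
  using finite_vimageI[of A Suc] by (simp add: vimage_def)

lemma finite_fn [simp]: "finite (fn s)" and finite_fnp [simp]: "finite (fnp P)"
  by (induction s and P) (auto simp: finite_Suc_vimage)

lemma ren_ren: "ren f (ren g s) = ren (f \<circ> g) s"
  and renp_renp: "renp f (renp g P) = renp (f \<circ> g) P"
  by (induction s and P arbitrary: f g and f g) (simp_all add: up_comp)

lemma ren_cong: "(\<And>k. k \<in> fn s \<Longrightarrow> f k = g k) \<Longrightarrow> ren f s = ren g s"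
  and renp_cong: "(\<And>k. k \<in> fnp P \<Longrightarrow> f k = g k) \<Longrightarrow> renp f P = renp g P"
proof (induction s and P arbitrary: f g and f g)
  case (DInp a P)
  have "renp (up f) P = renp (up g) P"
    by (rule DInp.IH) (use DInp.prems in \<open>auto simp: up_def split: nat.splits\<close>)
  then show ?case using DInp.prems by simp
next
  case (DRes s)
  have "ren (up f) s = ren (up g) s"
    by (rule DRes.IH) (use DRes.prems in \<open>auto simp: up_def split: nat.splits\<close>)
  then show ?case by simp
next
  case (Outp a x P)
  have "renp f P = renp g P" by (rule Outp.IH) (use Outp.prems in auto)
  then show ?case using Outp.prems by simp
next
  case (Match x y s)
  have "ren f s = ren g s" by (rule Match.IH) (use Match.prems in auto)
  then show ?case using Match.prems by simp
next
  case (Mismatch x y s)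
  have "ren f s = ren g s" by (rule Mismatch.IH) (use Mismatch.prems in auto)
  then show ?case using Mismatch.prems by simp
next
  case (Sum s t)
  have "ren f s = ren g s" "ren f t = ren g t"
    by (rule Sum.IH; use Sum.prems in auto)+
  then show ?case by simp
next
  case (Par s t)
  have "ren f s = ren g s" "ren f t = ren g t"
    by (rule Par.IH; use Par.prems in auto)+
  then show ?case by simp
next
  case (Choice P p Q)
  have "renp f P = renp g P" "renp f Q = renp g Q"
    by (rule Choice.IH; use Choice.prems in auto)+
  then show ?case by simp
next
  case (St s)
  have "ren f s = ren g s" by (rule St.IH) (use St.prems in auto)
  then show ?case by simp
next
  case Zero
  show ?case by simp
qed

lemma up_id: "up (\<lambda>k. k) = (\<lambda>k. k)"
  by (auto simp: fun_eq_iff up_def split: nat.splits)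

lemma ren_id: "ren id s = s" and renp_id: "renp id P = P"
  by (induction s and P) (simp_all add: up_id id_def)

lemma Suc_in_up_image: "Suc k \<in> up f ` A \<longleftrightarrow> k \<in> f ` {j. Suc j \<in> A}"
proof
  assume "Suc k \<in> up f ` A"
  then obtain j where "j \<in> A" "Suc k = up f j" by blast
  then show "k \<in> f ` {j. Suc j \<in> A}" by (cases j) auto
next
  assume "k \<in> f ` {j. Suc j \<in> A}"
  then obtain j where "Suc j \<in> A" "k = f j" by blast
  then show "Suc k \<in> up f ` A" by (metis image_eqI up_simps(2))
qed

lemma fn_ren: "fn (ren f s) = f ` fn s" and fnp_renp: "fnp (renp f P) = f ` fnp P"
  by (induction s and P arbitrary: f and f) (simp_all add: Suc_in_up_image image_Un)

definition unbnd :: "name \<Rightarrow> name \<Rightarrow> name" where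
  "unbnd x k = (case k of 0 \<Rightarrow> x | Suc j \<Rightarrow> j)"

lemma unbnd_bnd: "unbnd x \<circ> bnd x = id"
  by (auto simp: fun_eq_iff unbnd_def bnd_def)

lemma nu_inject: "nu x s = nu x t \<longleftrightarrow> s = t"
proof
  assume "nu x s = nu x t"
  then have "ren (unbnd x) (ren (bnd x) s) = ren (unbnd x) (ren (bnd x) t)"
    by (simp add: nu_def)
  then show "s = t" by (simp add: ren_ren unbnd_bnd ren_id)
qed simp

lemma inp_inject: "inp a x P = inp b x Q \<longleftrightarrow> a = b \<and> P = Q"
proof
  assume "inp a x P = inp b x Q"
  then have "a = b" and "renp (unbnd x) (renp (bnd x) P) = renp (unbnd x) (renp (bnd x) Q)"
    by (simp_all add: inp_def)
  then show "a = b \<and> P = Q" by (simp add: renp_renp unbnd_bnd renp_id)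
qed simp

lemma fn_nu: "fn (nu x s) = fn s - {x}"
  by (auto simp: nu_def fn_ren bnd_def image_iff split: if_splits)

lemma fn_inp: "fn (inp a x P) = insert a (fnp P - {x})"
  by (auto simp: inp_def fnp_renp bnd_def image_iff split: if_splits)

lemma nu_alpha: "y \<notin> fn s - {x} \<Longrightarrow> nu x s = nu y (subst s y x)"
  by (auto simp: nu_def subst_def ren_ren bnd_def intro!: ren_cong)

lemma inp_alpha: "y \<notin> fnp P - {x} \<Longrightarrow> inp a x P = inp a y (substp P y x)"
  by (auto simp: inp_def substp_def renp_renp bnd_def intro!: renp_cong)

lemma subst_nu: "z \<noteq> x \<Longrightarrow> z \<noteq> y \<Longrightarrow> subst (nu z s) y x = nu z (subst s y x)"
  by (auto simp: nu_def subst_def ren_ren bnd_def up_def intro!: ren_cong split: nat.splits)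

lemma subst_inp:
  "z \<noteq> x \<Longrightarrow> z \<noteq> y \<Longrightarrow> subst (inp a z P) y x = inp (if a = x then y else a) z (substp P y x)"
  by (auto simp: inp_def subst_def substp_def renp_renp bnd_def up_def
      intro!: renp_cong split: nat.splits)

lemma bnd_unbnd_on: "k \<noteq> Suc x \<Longrightarrow> bnd x (unbnd x k) = k"
  by (auto simp: unbnd_def bnd_def split: nat.splits)

lemma DRes_as_nu: "x \<notin> fn (DRes s) \<Longrightarrow> DRes s = nu x (ren (unbnd x) s)"
proof -
  assume "x \<notin> fn (DRes s)"
  then have "ren (bnd x \<circ> unbnd x) s = ren id s"
    by (intro ren_cong) (auto intro: bnd_unbnd_on)
  then show ?thesis by (simp add: nu_def ren_ren ren_id)
qed

lemma DInp_as_inp: "x \<notin> {k. Suc k \<in> fnp P} \<Longrightarrow> DInp a P = inp a x (renp (unbnd x) P)"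
proof -
  assume "x \<notin> {k. Suc k \<in> fnp P}"
  then have "renp (bnd x \<circ> unbnd x) P = renp id P"
    by (intro renp_cong) (auto intro: bnd_unbnd_on)
  then show ?thesis by (simp add: inp_def renp_renp renp_id)
qed

section \<open>Distributions\<close>

primrec interp :: "proc \<Rightarrow> state pmf" where
  "interp (St s) = return_pmf s"
| "interp (Choice P p Q) =
     bind_pmf (bernoulli_pmf (real_of_prob p)) (\<lambda>b. if b then interp P else interp Q)"

definition fnd :: "state pmf \<Rightarrow> name set" where
  "fnd \<Delta> = (\<Union>s\<in>set_pmf \<Delta>. fn s)"

definition pard :: "state pmf \<Rightarrow> state pmf \<Rightarrow> state pmf" where
  "pard \<Delta>1 \<Delta>2 = map_pmf (\<lambda>(s, t). Par s t) (pair_pmf \<Delta>1 \<Delta>2)"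

definition nud :: "name \<Rightarrow> state pmf \<Rightarrow> state pmf" where
  "nud x \<Delta> = map_pmf (nu x) \<Delta>"

definition substd :: "state pmf \<Rightarrow> name \<Rightarrow> name \<Rightarrow> state pmf" where
  "substd \<Delta> y x = map_pmf (\<lambda>s. subst s y x) \<Delta>"

lemma finite_set_interp [simp]: "finite (set_pmf (interp P))"
proof (induction P rule: proc.induct[where ?P1.0 = "\<lambda>_. True"])
  case (Choice P p Q)
  then show ?case by auto
qed auto

lemma pmf_interp_Choice:
  "pmf (interp (Choice P p Q)) s =
     real_of_prob p * pmf (interp P) s + (1 - real_of_prob p) * pmf (interp Q) s"
proof -
  have "0 < real_of_prob p" "real_of_prob p \<le> 1" using real_of_prob[of p] by auto
  then show ?thesis by (simp add: pmf_bind)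
qed

lemma pmf_pard: "pmf (pard \<Delta>1 \<Delta>2) (Par s t) = pmf \<Delta>1 s * pmf \<Delta>2 t"
proof -
  have "pmf (map_pmf (\<lambda>(s, t). Par s t) (pair_pmf \<Delta>1 \<Delta>2)) ((\<lambda>(s, t). Par s t) (s, t)) =
      pmf (pair_pmf \<Delta>1 \<Delta>2) (s, t)"
    by (rule pmf_map_inj') (auto simp: inj_def)
  then show ?thesis by (simp add: pard_def pmf_pair)
qed

lemma pmf_nud: "pmf (nud x \<Delta>) (nu x s) = pmf \<Delta> s"
  unfolding nud_def by (rule pmf_map_inj') (auto simp: inj_def nu_inject)

section \<open>Transitions\<close>

datatype act = Tau | In name name | Out name name | BOut name name

primrec bn :: "act \<Rightarrow> name set" where
  "bn Tau = {}"
| "bn (In a x) = {x}"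
| "bn (Out a x) = {}"
| "bn (BOut a x) = {x}"

primrec names :: "act \<Rightarrow> name set" where
  "names Tau = {}"
| "names (In a x) = {a, x}"
| "names (Out a x) = {a, x}"
| "names (BOut a x) = {a, x}"

inductive step :: "state \<Rightarrow> act \<Rightarrow> state pmf \<Rightarrow> bool" where
  Inp: "step (inp a x P) (In a x) (interp P)"
| Outp: "step (Outp a x P) (Out a x) (interp P)"
| SumL: "step s \<alpha> \<Delta> \<Longrightarrow> step (Sum s t) \<alpha> \<Delta>"
| SumR: "step s \<alpha> \<Delta> \<Longrightarrow> step (Sum t s) \<alpha> \<Delta>"
| Match: "step s \<alpha> \<Delta> \<Longrightarrow> step (Match x x s) \<alpha> \<Delta>"
| Mismatch: "step s \<alpha> \<Delta> \<Longrightarrow> x \<noteq> y \<Longrightarrow> step (Mismatch x y s) \<alpha> \<Delta>"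
| ParL: "step s \<alpha> \<Delta> \<Longrightarrow> bn \<alpha> \<inter> fn t = {} \<Longrightarrow> step (Par s t) \<alpha> (pard \<Delta> (return_pmf t))"
| ParR: "step s \<alpha> \<Delta> \<Longrightarrow> bn \<alpha> \<inter> fn t = {} \<Longrightarrow> step (Par t s) \<alpha> (pard (return_pmf t) \<Delta>)"
| ComL: "step s (In a x) \<Delta>1 \<Longrightarrow> step t (Out a y) \<Delta>2 \<Longrightarrow>
    step (Par s t) Tau (pard (substd \<Delta>1 y x) \<Delta>2)"
| ComR: "step s (In a x) \<Delta>1 \<Longrightarrow> step t (Out a y) \<Delta>2 \<Longrightarrow>
    step (Par t s) Tau (pard \<Delta>2 (substd \<Delta>1 y x))"
| CloseL: "step s (In a w) \<Delta>1 \<Longrightarrow> step t (BOut a w) \<Delta>2 \<Longrightarrow>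
    step (Par s t) Tau (nud w (pard \<Delta>1 \<Delta>2))"
| CloseR: "step s (In a w) \<Delta>1 \<Longrightarrow> step t (BOut a w) \<Delta>2 \<Longrightarrow>
    step (Par t s) Tau (nud w (pard \<Delta>2 \<Delta>1))"
| Res: "step s \<alpha> \<Delta> \<Longrightarrow> x \<notin> names \<alpha> \<Longrightarrow> step (nu x s) \<alpha> (nud x \<Delta>)"
| Open: "step s (Out x z) \<Delta> \<Longrightarrow> y \<noteq> x \<Longrightarrow> y \<notin> fn (nu z s) \<Longrightarrow>
    step (nu z s) (BOut x y) (substd \<Delta> y z)"

text \<open>
  A finite convex combination \<open>\<Sum>i\<in>I. p\<^sub>i \<cdot> \<Delta>\<^sub>i\<close> is \<open>bind_pmf p \<Delta>\<close> for a finitely supported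
  distribution \<open>p\<close> on indices (of type \<open>nat\<close>, without loss of generality).
\<close>

inductive lift :: "(state \<Rightarrow> state pmf \<Rightarrow> bool) \<Rightarrow> state pmf \<Rightarrow> state pmf \<Rightarrow> bool"
  for R where
  point: "R s \<Theta> \<Longrightarrow> lift R (return_pmf s) \<Theta>"
| convex: "finite (set_pmf p) \<Longrightarrow> (\<And>i::nat. i \<in> set_pmf p \<Longrightarrow> lift R (\<Delta> i) (\<Theta> i)) \<Longrightarrow>
    lift R (bind_pmf p \<Delta>) (bind_pmf p \<Theta>)"

definition stepd :: "act \<Rightarrow> state pmf \<Rightarrow> state pmf \<Rightarrow> bool" where
  "stepd \<alpha> = lift (\<lambda>s \<Delta>. step s \<alpha> \<Delta>)"

definition tauhat :: "state \<Rightarrow> state pmf \<Rightarrow> bool" where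
  "tauhat s \<Delta> \<longleftrightarrow> step s Tau \<Delta> \<or> \<Delta> = return_pmf s"

definition wtau :: "state pmf \<Rightarrow> state pmf \<Rightarrow> bool" where
  "wtau = (lift tauhat)\<^sup>*\<^sup>*"

definition wstep :: "act \<Rightarrow> state pmf \<Rightarrow> state pmf \<Rightarrow> bool" where
  "wstep \<alpha> \<Delta> \<Delta>' \<longleftrightarrow>
     (if \<alpha> = Tau then wtau \<Delta> \<Delta>'
      else \<exists>\<Delta>1 \<Delta>2. wtau \<Delta> \<Delta>1 \<and> stepd \<alpha> \<Delta>1 \<Delta>2 \<and> wtau \<Delta>2 \<Delta>')"

section \<open>Simulation preorders\<close>

datatype chan = Nm name | Co name

primrec barb :: "state \<Rightarrow> chan \<Rightarrow> bool" where
  "barb s (Nm a) \<longleftrightarrow> (\<exists>x \<Delta>. step s (In a x) \<Delta>)"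
| "barb s (Co a) \<longleftrightarrow> (\<exists>x \<Delta>. step s (BOut a x) \<Delta> \<or> step s (Out a x) \<Delta>)"

definition refuses :: "state \<Rightarrow> chan set \<Rightarrow> bool" where
  "refuses s X \<longleftrightarrow> \<not> (\<exists>\<Delta>. step s Tau \<Delta>) \<and> (\<forall>\<mu>\<in>X. \<not> barb s \<mu>)"

definition refusesd :: "state pmf \<Rightarrow> chan set \<Rightarrow> bool" where
  "refusesd \<Delta> X \<longleftrightarrow> (\<forall>s\<in>set_pmf \<Delta>. refuses s X)"

text \<open>The finiteness conjunct says that the relation is one between states and finitely supported
  distributions.\<close>

definition simulation :: "(state \<Rightarrow> state pmf \<Rightarrow> bool) \<Rightarrow> bool" where
  "simulation R \<longleftrightarrow> (\<forall>s \<Theta>. R s \<Theta> \<longrightarrow>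
     finite (set_pmf \<Theta>) \<and>
     (\<forall>a x \<Delta>. step s (In a x) \<Delta> \<and> x \<notin> fn s \<union> fnd \<Theta> \<longrightarrow>
        (\<forall>w. \<exists>\<Theta>1 \<Theta>2 \<Theta>'. wtau \<Theta> \<Theta>1 \<and> stepd (In a x) \<Theta>1 \<Theta>2 \<and>
           wtau (substd \<Theta>2 w x) \<Theta>' \<and> lift R (substd \<Delta> w x) \<Theta>')) \<and>
     (\<forall>\<alpha> \<Delta>. step s \<alpha> \<Delta> \<and> (\<forall>a x. \<alpha> \<noteq> In a x) \<longrightarrow>
        (\<exists>\<Theta>'. wstep \<alpha> \<Theta> \<Theta>' \<and> lift R \<Delta> \<Theta>')))"

definition failure_simulation :: "(state \<Rightarrow> state pmf \<Rightarrow> bool) \<Rightarrow> bool" where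
  "failure_simulation R \<longleftrightarrow> simulation R \<and>
     (\<forall>s \<Theta>. R s \<Theta> \<longrightarrow>
        (\<forall>X. refuses s X \<longrightarrow> (\<exists>\<Theta>'. wtau \<Theta> \<Theta>' \<and> refusesd \<Theta>' X)))"

definition simS :: "state \<Rightarrow> state pmf \<Rightarrow> bool" where
  "simS s \<Theta> \<longleftrightarrow> (\<exists>R. simulation R \<and> R s \<Theta>)"

definition simFS :: "state \<Rightarrow> state pmf \<Rightarrow> bool" where
  "simFS s \<Theta> \<longleftrightarrow> (\<exists>R. failure_simulation R \<and> R s \<Theta>)"

lemma lift_mono: "lift R \<Delta> \<Theta> \<Longrightarrow> (\<And>s \<Theta>. R s \<Theta> \<Longrightarrow> R' s \<Theta>) \<Longrightarrow> lift R' \<Delta> \<Theta>"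
  by (induction rule: lift.induct) (auto intro: lift.intros)

lemma simulation_Union:
  assumes "\<And>R. R \<in> \<R> \<Longrightarrow> simulation R"
  shows "simulation (\<lambda>s \<Theta>. \<exists>R\<in>\<R>. R s \<Theta>)" (is "simulation ?U")
  unfolding simulation_def
proof (intro allI impI conjI)
  fix s \<Theta> assume "?U s \<Theta>"
  then obtain R where R: "R \<in> \<R>" "R s \<Theta>" by blast
  have m: "lift ?U \<Delta> \<Theta>'" if "lift R \<Delta> \<Theta>'" for \<Delta> \<Theta>'
    using that by (rule lift_mono) (use R in blast)
  note sim = assms[OF R(1), unfolded simulation_def, rule_format, OF R(2)]
  show "finite (set_pmf \<Theta>)" using sim by blast
  show "\<exists>\<Theta>1 \<Theta>2 \<Theta>'. wtau \<Theta> \<Theta>1 \<and> stepd (In a x) \<Theta>1 \<Theta>2 \<and>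
      wtau (substd \<Theta>2 w x) \<Theta>' \<and> lift ?U (substd \<Delta> w x) \<Theta>'"
    if "step s (In a x) \<Delta> \<and> x \<notin> fn s \<union> fnd \<Theta>" for a x \<Delta> w
  proof -
    have "\<exists>\<Theta>1 \<Theta>2 \<Theta>'. wtau \<Theta> \<Theta>1 \<and> stepd (In a x) \<Theta>1 \<Theta>2 \<and>
        wtau (substd \<Theta>2 w x) \<Theta>' \<and> lift R (substd \<Delta> w x) \<Theta>'"
      using sim that by blast
    then show ?thesis using m by blast
  qed
  show "\<exists>\<Theta>'. wstep \<alpha> \<Theta> \<Theta>' \<and> lift ?U \<Delta> \<Theta>'"
    if "step s \<alpha> \<Delta> \<and> (\<forall>a x. \<alpha> \<noteq> In a x)" for \<alpha> \<Delta>
  proof -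
    have "\<exists>\<Theta>'. wstep \<alpha> \<Theta> \<Theta>' \<and> lift R \<Delta> \<Theta>'" using sim that by blast
    then show ?thesis using m by blast
  qed
qed

lemma simulation_simS: "simulation simS"
proof -
  have "simS = (\<lambda>s \<Theta>. \<exists>R\<in>Collect simulation. R s \<Theta>)"
    by (intro ext) (simp add: simS_def)
  then show ?thesis using simulation_Union[of "Collect simulation"] by simp
qed

lemma failure_simulation_simFS: "failure_simulation simFS"
proof -
  have "simFS = (\<lambda>s \<Theta>. \<exists>R\<in>Collect failure_simulation. R s \<Theta>)"
    by (intro ext) (simp add: simFS_def)
  then have "simulation simFS"
    using simulation_Union[of "Collect failure_simulation"]
    by (simp add: failure_simulation_def)
  moreover have "\<exists>\<Theta>'. wtau \<Theta> \<Theta>' \<and> refusesd \<Theta>' X"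
    if "simFS s \<Theta>" "refuses s X" for s \<Theta> X
  proof -
    from that(1) obtain R where "failure_simulation R" "R s \<Theta>" by (auto simp: simFS_def)
    with that(2) show ?thesis unfolding failure_simulation_def by blast
  qed
  ultimately show ?thesis unfolding failure_simulation_def by blast
qed

definition preS :: "proc \<Rightarrow> proc \<Rightarrow> bool" where
  "preS P Q \<longleftrightarrow> (\<exists>\<Theta>. wtau (interp Q) \<Theta> \<and> lift simS (interp P) \<Theta>)"

definition preFS :: "proc \<Rightarrow> proc \<Rightarrow> bool" where
  "preFS P Q \<longleftrightarrow> (\<exists>\<Theta>. wtau (interp P) \<Theta> \<and> lift simFS (interp Q) \<Theta>)"

section \<open>Testing preorders\<close>

definition omega :: name where
  "omega = 0"

text \<open>
  \<open>testp_at w T\<close>: the name with index \<open>w\<close> occurs in \<open>T\<close> only within output prefixes on channel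
  \<open>w\<close>. The object of such a prefix is arbitrary and may be \<open>w\<close> itself. This matters:
  \<open>test_apply\<close> restricts all other free names and success is a free output, so
  an object different from \<open>omega\<close> would turn the output into a bound one.
\<close>

primrec test_at :: "name \<Rightarrow> state \<Rightarrow> bool" and testp_at :: "name \<Rightarrow> proc \<Rightarrow> bool" where
  "test_at w Zero \<longleftrightarrow> True"
| "test_at w (DInp a P) \<longleftrightarrow> a \<noteq> w \<and> testp_at (Suc w) P"
| "test_at w (Outp a x P) \<longleftrightarrow> (x = w \<longrightarrow> a = w) \<and> testp_at w P"
| "test_at w (Match x y s) \<longleftrightarrow> x \<noteq> w \<and> y \<noteq> w \<and> test_at w s"
| "test_at w (Mismatch x y s) \<longleftrightarrow> x \<noteq> w \<and> y \<noteq> w \<and> test_at w s"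
| "test_at w (Sum s t) \<longleftrightarrow> test_at w s \<and> test_at w t"
| "test_at w (Par s t) \<longleftrightarrow> test_at w s \<and> test_at w t"
| "test_at w (DRes s) \<longleftrightarrow> test_at (Suc w) s"
| "testp_at w (St s) \<longleftrightarrow> test_at w s"
| "testp_at w (Choice P p Q) \<longleftrightarrow> testp_at w P \<and> testp_at w Q"

definition is_test :: "proc \<Rightarrow> bool" where
  "is_test T \<longleftrightarrow> testp_at omega T"

definition success :: "state \<Rightarrow> bool" where
  "success s \<longleftrightarrow> (\<exists>b \<Delta>. step s (Out omega b) \<Delta>)"

text \<open>The recursive equations for the outcome sets, read as an inductive definition;
  \<open>outcomes_eq\<close> below recovers them.\<close>

inductive outcome :: "state \<Rightarrow> real \<Rightarrow> bool" where
  "success s \<Longrightarrow> outcome s 1"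
| "\<not> success s \<Longrightarrow> step s Tau \<Delta> \<Longrightarrow> (\<And>t. t \<in> set_pmf \<Delta> \<Longrightarrow> outcome t (f t)) \<Longrightarrow>
    outcome s (\<Sum>t\<in>set_pmf \<Delta>. pmf \<Delta> t * f t)"
| "\<not> success s \<Longrightarrow> \<not> (\<exists>\<Delta>. step s Tau \<Delta>) \<Longrightarrow> outcome s 0"

definition outcomes :: "state \<Rightarrow> real set" where
  "outcomes s = {r. outcome s r}"

definition outcomesd :: "state pmf \<Rightarrow> real set" where
  "outcomesd \<Delta> =
     {\<Sum>s\<in>set_pmf \<Delta>. pmf \<Delta> s * f s | f. \<forall>s\<in>set_pmf \<Delta>. f s \<in> outcomes s}"

lemma outcomes_eq:
  "outcomes s =
     (if success s then {1}
      else if \<exists>\<Delta>. step s Tau \<Delta> then \<Union> {outcomesd \<Delta> | \<Delta>. step s Tau \<Delta>}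
      else {0})"
proof (intro set_eqI)
  fix r
  have "outcome s r \<longleftrightarrow>
      success s \<and> r = 1 \<or>
      \<not> success s \<and> (\<exists>\<Delta>. step s Tau \<Delta> \<and> r \<in> outcomesd \<Delta>) \<or>
      \<not> success s \<and> \<not> (\<exists>\<Delta>. step s Tau \<Delta>) \<and> r = 0"
    unfolding outcome.simps[of s r] outcomesd_def outcomes_def by blast
  then show "r \<in> outcomes s \<longleftrightarrow> r \<in>
     (if success s then {1}
      else if \<exists>\<Delta>. step s Tau \<Delta> then \<Union> {outcomesd \<Delta> | \<Delta>. step s Tau \<Delta>}
      else {0})"
    unfolding outcomes_def[of s] by (simp only: mem_Collect_eq) (simp, blast)
qed

text \<open>\<open>\<nu>x\<^sub>1\<dots>x\<^sub>n.(T|P)\<close> is interpreted by the operations on distributions.\<close>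

definition test_apply :: "proc \<Rightarrow> proc \<Rightarrow> real set" where
  "test_apply T P =
     outcomesd (foldr nud (sorted_list_of_set ((fnp T \<union> fnp P) - {omega}))
       (pard (interp T) (interp P)))"

definition leHo :: "real set \<Rightarrow> real set \<Rightarrow> bool" where
  "leHo O1 O2 \<longleftrightarrow> (\<forall>o1\<in>O1. \<exists>o2\<in>O2. o1 \<le> o2)"

definition leSm :: "real set \<Rightarrow> real set \<Rightarrow> bool" where
  "leSm O1 O2 \<longleftrightarrow> (\<forall>o2\<in>O2. \<exists>o1\<in>O1. o1 \<le> o2)"

definition pmay :: "proc \<Rightarrow> proc \<Rightarrow> bool" where
  "pmay P Q \<longleftrightarrow> (\<forall>T. is_test T \<longrightarrow> leHo (test_apply T P) (test_apply T Q))"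

definition pmust :: "proc \<Rightarrow> proc \<Rightarrow> bool" where
  "pmust P Q \<longleftrightarrow> (\<forall>T. is_test T \<longrightarrow> leSm (test_apply T P) (test_apply T Q))"

end

theory Submission
  imports Defs
begin

text \<open>
  Simulations are compared directly in the context of a test: along the \<open>\<tau>\<close>-steps of
  \<open>\<nu>w\<^sub>1\<dots>w\<^sub>n. (t | s)\<close> the shape of the term is preserved, and every such step is matched by weak
  \<open>\<tau>\<close>-steps of \<open>\<nu>w\<^sub>1\<dots>w\<^sub>n. (t | \<Theta>)\<close> whenever \<open>\<Theta>\<close> simulates \<open>s\<close>. As \<open>omega\<close> cannot be passed from the
  test to the process, only \<open>t\<close> can succeed, hence success is present on both sides or on neither, and
  the weak \<open>\<tau>\<close>-steps of \<open>\<Theta>\<close> pass through no successful state unless \<open>t\<close> is itself successful. If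
  \<open>t | s\<close> is deadlocked, its outcome \<open>0\<close> is a lower bound in the may case; in the must case the
  refusal clause, applied to the set of all partners offered by \<open>t\<close>, moves \<open>\<Theta>\<close> to a deadlock of
  \<open>t | \<Theta>\<close>. Processes being finite, induction on the number of prefixes compares the outcomes.
\<close>

subsection \<open>Renaming distributions\<close>

abbreviation rend :: "(name \<Rightarrow> name) \<Rightarrow> state pmf \<Rightarrow> state pmf" where
  "rend f \<equiv> map_pmf (ren f)"

primrec rena :: "(name \<Rightarrow> name) \<Rightarrow> act \<Rightarrow> act" where
  "rena f Tau = Tau"
| "rena f (In a x) = In (f a) (f x)"
| "rena f (Out a x) = Out (f a) (f x)"
| "rena f (BOut a x) = BOut (f a) (f x)"

lemma bn_rena: "bn (rena f \<alpha>) = f ` bn \<alpha>"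
  by (cases \<alpha>) auto

lemma names_rena: "names (rena f \<alpha>) = f ` names \<alpha>"
  by (cases \<alpha>) auto

lemma up_bnd: "inj f \<Longrightarrow> up f \<circ> bnd x = bnd (f x) \<circ> f"
  by (auto simp: fun_eq_iff bnd_def inj_eq)

lemma ren_nu: "inj f \<Longrightarrow> ren f (nu x s) = nu (f x) (ren f s)"
  by (simp add: nu_def ren_ren up_bnd)

lemma ren_inp: "inj f \<Longrightarrow> ren f (inp a x P) = inp (f a) (f x) (renp f P)"
  by (simp add: inp_def renp_renp up_bnd)

lemma interp_renp: "interp (renp f P) = rend f (interp P)"
  by (induction P rule: proc.induct[where ?P1.0 = "\<lambda>_. True"])
     (auto simp: map_bind_pmf intro!: bind_pmf_cong)

lemma rend_pard: "rend f (pard \<Delta>1 \<Delta>2) = pard (rend f \<Delta>1) (rend f \<Delta>2)"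
  by (simp add: pard_def pair_map_pmf1 pair_map_pmf2 map_pmf_comp case_prod_beta)

lemma rend_nud: "inj f \<Longrightarrow> rend f (nud x \<Delta>) = nud (f x) (rend f \<Delta>)"
  by (simp add: nud_def map_pmf_comp ren_nu)

lemma rend_rend: "rend f (rend g \<Delta>) = rend (f \<circ> g) \<Delta>"
  by (simp add: map_pmf_comp ren_ren)

lemma substd_rend: "substd \<Delta> y x = rend (id(x := y)) \<Delta>"
  by (simp add: substd_def subst_def)

lemma rend_substd: "inj f \<Longrightarrow> rend f (substd \<Delta> y x) = substd (rend f \<Delta>) (f y) (f x)"
  unfolding substd_rend rend_rend
  by (rule arg_cong[of _ _ "\<lambda>h. rend h \<Delta>"]) (auto simp: fun_eq_iff inj_eq)

lemma rend_cong: "(\<And>k. k \<in> fnd \<Delta> \<Longrightarrow> f k = g k) \<Longrightarrow> rend f \<Delta> = rend g \<Delta>"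
  by (intro map_pmf_cong refl ren_cong) (auto simp: fnd_def)

lemma substd_same: "substd \<Delta> w w = \<Delta>"
proof -
  have "id(w := w) = id" by (simp add: fun_eq_iff)
  then show ?thesis by (simp add: substd_def subst_def ren_id)
qed

lemma fnd_rend: "fnd (rend f \<Delta>) = f ` fnd \<Delta>"
  by (auto simp: fnd_def fn_ren)

lemma set_pard: "set_pmf (pard \<Delta>1 \<Delta>2) = (\<lambda>(s, t). Par s t) ` (set_pmf \<Delta>1 \<times> set_pmf \<Delta>2)"
  by (simp add: pard_def)

lemma set_pmf_some: "\<exists>s. s \<in> set_pmf \<Delta>"
  using set_pmf_not_empty[of \<Delta>] by blast

lemma fnd_pard: "fnd (pard \<Delta>1 \<Delta>2) = fnd \<Delta>1 \<union> fnd \<Delta>2"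
  using set_pmf_some[of \<Delta>1] set_pmf_some[of \<Delta>2] by (fastforce simp: fnd_def set_pard)

lemma fnd_nud: "fnd (nud x \<Delta>) = fnd \<Delta> - {x}"
  by (auto simp: fnd_def nud_def fn_nu)

lemma fnd_substd: "fnd (substd \<Delta> y x) = id(x := y) ` fnd \<Delta>"
  by (simp add: substd_rend fnd_rend)

lemma fnd_return: "fnd (return_pmf s) = fn s"
  by (simp add: fnd_def)

lemma fnd_interp: "fnd (interp P) \<subseteq> fnp P"
  by (induction P rule: proc.induct[where ?P1.0 = "\<lambda>_. True"])
     (fastforce simp: fnd_def split: if_splits)+

lemma finite_fnd: "finite (set_pmf \<Delta>) \<Longrightarrow> finite (fnd \<Delta>)"
  by (simp add: fnd_def)

lemma pard_return_right: "pard \<Delta> (return_pmf t) = map_pmf (\<lambda>s. Par s t) \<Delta>"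
  by (simp add: pard_def pair_return_pmf2 map_pmf_comp)

lemma pard_return_left: "pard (return_pmf t) \<Delta> = map_pmf (Par t) \<Delta>"
  by (simp add: pard_def pair_return_pmf1 map_pmf_comp)

lemma pard_bind: "pard \<Delta>1 \<Delta>2 = bind_pmf \<Delta>1 (\<lambda>t. map_pmf (Par t) \<Delta>2)"
  by (simp add: pard_def pair_pmf_def map_bind_pmf map_pmf_def bind_assoc_pmf bind_return_pmf)

text \<open>Samples the process component first. This is the shape
  \<open>bind_pmf \<Theta> k\<close> in which \<open>lift_map_bind\<close> and
  \<open>lift_pointwise\<close> deliver lifted moves.\<close>

lemma pard_bind_right: "pard \<Delta>1 \<Delta>2 = bind_pmf \<Delta>2 (\<lambda>s. map_pmf (\<lambda>t. Par t s) \<Delta>1)"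
  unfolding pard_bind map_pmf_def by (rule bind_commute_pmf)

subsection \<open>Names in transitions\<close>

lemma step_finite: "step s \<alpha> \<Delta> \<Longrightarrow> finite (set_pmf \<Delta>)"
  by (induction rule: step.induct) (auto simp: set_pard nud_def substd_def)

lemma step_In_fn: "step s \<alpha> \<Delta> \<Longrightarrow> \<alpha> = In a x \<Longrightarrow> a \<in> fn s"
  by (induction rule: step.induct) (auto simp: fn_inp fn_nu)

lemma step_Out_fn: "step s \<alpha> \<Delta> \<Longrightarrow> \<alpha> = Out a x \<Longrightarrow> a \<in> fn s \<and> x \<in> fn s"
  by (induction rule: step.induct) (auto simp: fn_nu)

text \<open>In a communication the object substituted for the input name is free in the sender;
  elsewhere the only new name is the one bound by the action.\<close>

lemma step_fn: "step s \<alpha> \<Delta> \<Longrightarrow> fnd \<Delta> \<subseteq> fn s \<union> bn \<alpha>"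
proof (induction rule: step.induct)
  case (ComL s a x \<Delta>1 t y \<Delta>2)
  then show ?case using step_Out_fn[OF ComL(2)]
    by (auto simp: fnd_pard fnd_substd split: if_splits)
next
  case (ComR s a x \<Delta>1 t y \<Delta>2)
  then show ?case using step_Out_fn[OF ComR(2)]
    by (auto simp: fnd_pard fnd_substd split: if_splits)
next
  case (Inp a x P)
  then show ?case using fnd_interp[of P] by (auto simp: fn_inp)
next
  case (Outp a x P)
  then show ?case using fnd_interp[of P] by auto
qed (auto simp: fnd_pard fnd_nud fnd_substd fnd_return fn_nu split: if_splits)

text \<open>Injectivity keeps \<open>Mismatch\<close> guards true and preserves the freshness side
  conditions.\<close>

lemma step_rename:
  assumes "step s \<alpha> \<Delta>" and f: "inj f"
  shows "step (ren f s) (rena f \<alpha>) (rend f \<Delta>)"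
  using assms(1)
proof (induction rule: step.induct)
  case (Inp a x P)
  then show ?case using step.Inp[of "f a" "f x" "renp f P"] f by (simp add: ren_inp interp_renp)
next
  case (Outp a x P)
  then show ?case using step.Outp[of "f a" "f x" "renp f P"] by (simp add: interp_renp)
next
  case (ParL s \<alpha> \<Delta> t)
  then show ?case
    using step.ParL[of "ren f s" "rena f \<alpha>" "rend f \<Delta>" "ren f t"] f
    by (simp add: bn_rena fn_ren rend_pard image_Int[symmetric])
next
  case (ParR s \<alpha> \<Delta> t)
  then show ?case
    using step.ParR[of "ren f s" "rena f \<alpha>" "rend f \<Delta>" "ren f t"] f
    by (simp add: bn_rena fn_ren rend_pard image_Int[symmetric])
next
  case (Res s \<alpha> \<Delta> x)
  then show ?case
    using step.Res[of "ren f s" "rena f \<alpha>" "rend f \<Delta>" "f x"] f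
    by (simp add: names_rena ren_nu rend_nud inj_image_mem_iff)
next
  case (Open s x z \<Delta> y)
  have "f y \<notin> fn (nu (f z) (ren f s))"
    using Open.hyps f by (auto simp: fn_nu fn_ren inj_image_mem_iff inj_eq)
  then show ?case
    using step.Open[of "ren f s" "f x" "f z" "rend f \<Delta>" "f y"] Open f
    by (simp add: ren_nu rend_substd inj_eq)
qed (use f in \<open>simp_all add: step.intros rend_pard rend_substd rend_nud inj_eq\<close>)

primrec rebind :: "(name \<Rightarrow> name) \<Rightarrow> name \<Rightarrow> act \<Rightarrow> act" where
  "rebind f y Tau = Tau"
| "rebind f y (In a x) = In (f a) y"
| "rebind f y (Out a x) = Out (f a) (f x)"
| "rebind f y (BOut a x) = BOut (f a) y"

primrec chans :: "act \<Rightarrow> name set" where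
  "chans Tau = {}"
| "chans (In a x) = {a}"
| "chans (Out a x) = {a}"
| "chans (BOut a x) = {a}"

lemma ren_fun_upd_nu:
  assumes "inj f" "z \<noteq> x" "y \<noteq> f z"
  shows "ren (f(x := y)) (nu z s) = nu (f z) (ren (f(x := y)) s)"
  using assms unfolding nu_def
  by (auto simp: ren_ren bnd_def inj_eq intro!: ren_cong)

text \<open>The restriction case when \<open>y\<close> does not collide with the image of the
  restricted name. The colliding case is reduced to it by changing the renaming.\<close>

lemma step_rebind_Res:
  assumes IH: "step (ren f s) (rebind f y \<alpha>) (rend (f(x := y)) \<Delta>)"
    and f: "inj f" and x: "bn \<alpha> = {x}" and z: "z \<notin> names \<alpha>" and y: "y \<noteq> f z"
  shows "step (ren f (nu z s)) (rebind f y \<alpha>) (rend (f(x := y)) (nud z \<Delta>))"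
proof -
  have "f z \<notin> names (rebind f y \<alpha>)"
    using x y z f by (cases \<alpha>) (auto simp: inj_eq)
  moreover have "z \<noteq> x" using x z by (cases \<alpha>) auto
  ultimately show ?thesis
    using step.Res[OF IH, of "f z"] f y
    by (simp add: ren_nu nud_def map_pmf_comp ren_fun_upd_nu)
qed

text \<open>Renaming the free names by an injection \<open>f\<close> and the bound name of the action to an arbitrary
  fresh \<open>y\<close> has to be done simultaneously, since \<open>y\<close> may clash with a restriction passed in the
  derivation. The channel of a bound output need not be free in \<open>s\<close> (the rule \<open>Open\<close> does
  not exclude \<open>z = x\<close>), whence the separate freshness condition on channels.\<close>

lemma step_rebind:
  assumes "step s \<alpha> \<Delta>" and "bn \<alpha> = {x}" and "inj f" and "y \<notin> f ` fn s" and "y \<notin> f ` chans \<alpha>"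
  shows "step (ren f s) (rebind f y \<alpha>) (rend (f(x := y)) \<Delta>)"
  using assms
proof (induction arbitrary: f y rule: step.induct)
  case (Inp a x' P)
  then have [simp]: "x' = x" by simp
  have "renp (up f) (renp (bnd x) P) = renp (bnd y) (renp (f(x := y)) P)"
    unfolding renp_renp using Inp by (intro renp_cong) (auto simp: bnd_def fn_inp)
  then have "ren f (inp a x P) = inp (f a) y (renp (f(x := y)) P)"
    by (simp add: inp_def)
  then show ?case using step.Inp[of "f a" y "renp (f(x := y)) P"]
    by (simp only: interp_renp rebind.simps \<open>x' = x\<close>)
next
  case (ParL s \<alpha> \<Delta> t)
  have "ren (f(x := y)) t = ren f t" using ParL by (intro ren_cong) auto
  moreover have "bn (rebind f y \<alpha>) = {y}" using ParL.prems by (cases \<alpha>) auto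
  ultimately show ?case
    using step.ParL[OF ParL.IH[of f y], of "ren f t"] ParL.prems
    by (simp add: rend_pard fn_ren image_Un del: fun_upd_apply)
next
  case (ParR s \<alpha> \<Delta> t)
  have "ren (f(x := y)) t = ren f t" using ParR by (intro ren_cong) auto
  moreover have "bn (rebind f y \<alpha>) = {y}" using ParR.prems by (cases \<alpha>) auto
  ultimately show ?case
    using step.ParR[OF ParR.IH[of f y], of "ren f t"] ParR.prems
    by (simp add: rend_pard fn_ren image_Un del: fun_upd_apply)
next
  case (Mismatch s \<alpha> \<Delta> x y)
  then show ?case by (simp add: step.Mismatch inj_eq)
next
  case (Res s \<alpha> \<Delta> z)
  show ?case
  proof (cases "y = f z")
    case False
    then have "y \<notin> f ` fn s" using Res.prems by (auto simp: fn_nu)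
    then show ?thesis
      by (intro step_rebind_Res Res.IH) (use Res.prems Res.hyps(2) False in auto)
  next
    case True
    \<comment> \<open>Now \<open>y\<close> collides with the image of the restricted name
      \<open>z\<close>. Since \<open>z\<close> is bound in \<open>nu z s\<close>, its image may be
      moved to a fresh \<open>w\<close>: \<open>g\<close> does so and agrees with \<open>f\<close>
      on all other relevant names.\<close>
    have "finite (f ` fn s \<union> f ` chans \<alpha> \<union> {f z})" by (cases \<alpha>) auto
    from ex_new_if_finite[OF infinite_UNIV_nat this]
    obtain w where w: "w \<notin> f ` fn s \<union> f ` chans \<alpha> \<union> {f z}" ..
    define g where "g = Transposition.transpose (f z) w \<circ> f"
    have g: "inj g" unfolding g_def using \<open>inj f\<close> by (simp add: inj_compose)
    have gz: "g z = w" by (simp add: g_def)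
    have eq: "g k = f k" if "k \<in> fn s \<union> chans \<alpha>" "k \<noteq> z" for k
      using that w \<open>inj f\<close> unfolding g_def comp_def
      by (intro transpose_apply_other) (auto simp: inj_eq)
    have "z \<notin> chans \<alpha>" using Res.hyps by (cases \<alpha>) auto
    then have ch: "g k = f k" if "k \<in> chans \<alpha>" for k using that eq by auto
    have "y \<noteq> g k" if "k \<in> fn s" for k
      using that eq[of k] gz w True \<open>inj f\<close> by (cases "k = z") (auto simp: inj_eq)
    moreover have "y \<noteq> g k" if "k \<in> chans \<alpha>" for k
      using that ch[of k] Res.prems by auto
    ultimately have "step (ren g s) (rebind g y \<alpha>) (rend (g(x := y)) \<Delta>)"
      by (intro Res.IH) (use Res.prems g in auto)
    then have "step (ren g (nu z s)) (rebind g y \<alpha>) (rend (g(x := y)) (nud z \<Delta>))"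
      by (rule step_rebind_Res) (use Res.prems Res.hyps(2) g gz w True in auto)
    moreover have "ren g (nu z s) = ren f (nu z s)"
      by (intro ren_cong eq) (auto simp: fn_nu)
    moreover have "rebind g y \<alpha> = rebind f y \<alpha>"
      using ch Res.prems by (cases \<alpha>) auto
    moreover have "rend (g(x := y)) (nud z \<Delta>) = rend (f(x := y)) (nud z \<Delta>)"
      using step_fn[OF Res.hyps(1)] Res.prems by (intro rend_cong) (auto simp: fnd_nud eq)
    ultimately show ?thesis by (simp del: fun_upd_apply)
  qed
next
  case (Open s a z \<Delta> x')
  then have [simp]: "x' = x" by simp
  have *: "y \<notin> fn (nu (f z) (ren f s))"
    using Open.prems by (auto simp: fn_nu fn_ren)
  \<comment> \<open>The premise is a free output, so plain renaming suffices; the extruded name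
    \<open>z\<close> is then sent to \<open>y\<close> directly rather than through
    \<open>x\<close>.\<close>
  have "step (ren f s) (Out (f a) (f z)) (rend f \<Delta>)"
    using step_rename[OF Open.hyps(1), of f] Open.prems by simp
  then have "step (ren f (nu z s)) (BOut (f a) y) (substd (rend f \<Delta>) y (f z))"
    using step.Open[OF _ _ *] Open.prems by (simp add: ren_nu)
  moreover have "substd (rend f \<Delta>) y (f z) = rend (f(x := y)) (substd \<Delta> x z)"
    unfolding substd_rend rend_rend
    using step_fn[OF Open.hyps(1)] Open.hyps(3) Open.prems
    by (intro rend_cong) (auto simp: inj_eq fn_nu)
  ultimately show ?case by (simp del: fun_upd_apply)
qed (simp_all add: step.intros image_Un)

section \<open>Alpha-conversion of actions and restrictions\<close>

lemma step_alpha_In: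
  assumes "step s (In a x) \<Delta>" "y \<notin> fn s"
  shows "step s (In a y) (substd \<Delta> y x)"
  using step_rebind[of s "In a x" \<Delta> x id y] assms step_In_fn[OF assms(1) refl]
  by (auto simp: ren_id substd_rend)

lemma step_alpha_BOut:
  assumes "step s (BOut a x) \<Delta>" "y \<notin> fn s" "y \<noteq> a"
  shows "step s (BOut a y) (substd \<Delta> y x)"
  using step_rebind[of s "BOut a x" \<Delta> x id y] assms by (auto simp: ren_id substd_rend)

text \<open>As \<open>y\<close> is fresh, the second substitution hits only what the first one
  produced. Hence refreshing the bound name of an input does not change the residual of a
  communication.\<close>

lemma substd_substd:
  assumes "fnd \<Delta> \<subseteq> insert x A" "y \<notin> A"
  shows "substd (substd \<Delta> y x) z y = substd \<Delta> z x"
  unfolding substd_rend rend_rend using assms by (intro rend_cong) auto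

lemma nud_alpha:
  assumes "y \<notin> fnd \<Delta> - {x}"
  shows "nud x \<Delta> = nud y (substd \<Delta> y x)"
  unfolding nud_def substd_def map_pmf_comp using assms
  by (intro map_pmf_cong refl nu_alpha) (auto simp: fnd_def)

text \<open>Removing the binder of \<open>x'\<close> with \<open>unbnd x\<close> sends
  \<open>x'\<close> to \<open>x\<close> and fixes every other name; on \<open>fn s'\<close> this is
  a transposition, hence injective as \<open>step_rename\<close> requires.\<close>

lemma nu_eqD:
  assumes "nu x s = nu x' s'"
  shows "s = ren (Transposition.transpose x x') s'" and "x' \<noteq> x \<Longrightarrow> x \<notin> fn s'"
proof -
  have fn: "fn s - {x} = fn s' - {x'}" using fn_nu[of x s] fn_nu[of x' s'] assms by simp
  then show "x' \<noteq> x \<Longrightarrow> x \<notin> fn s'" by auto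
  have "s = ren (unbnd x) (ren (bnd x) s)" by (simp add: ren_ren unbnd_bnd ren_id)
  also have "ren (bnd x) s = ren (bnd x') s'" using assms by (simp add: nu_def)
  also have "ren (unbnd x) \<dots> = ren (Transposition.transpose x x') s'"
    unfolding ren_ren using fn
    by (intro ren_cong) (auto simp: unbnd_def bnd_def Transposition.transpose_def)
  finally show "s = ren (Transposition.transpose x x') s'" .
qed

text \<open>Rule inversion only yields some representative of the restricted term; its derivation is
  carried to the given one along the transposition. The absence of bound names excludes
  \<open>Open\<close>.\<close>

lemma step_nu_cases:
  assumes "step (nu x s) \<alpha> \<Delta>" and "bn \<alpha> = {}" and x: "x \<notin> names \<alpha>"
  obtains \<Delta>' where "step s \<alpha> \<Delta>'" and "\<Delta> = nud x \<Delta>'"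
  using assms(1)
proof cases
  case (Res s' \<Delta>' x')
  let ?f = "Transposition.transpose x x'"
  have s: "s = ren ?f s'" and fresh: "x' \<noteq> x \<Longrightarrow> x \<notin> fn s'"
    using nu_eqD[OF Res(1)] by auto
  have "rena ?f \<alpha> = \<alpha>" using Res x by (cases \<alpha>) (auto simp: Transposition.transpose_def)
  moreover have "step (ren ?f s') (rena ?f \<alpha>) (rend ?f \<Delta>')"
    using Res by (intro step_rename) auto
  ultimately have "step s \<alpha> (rend ?f \<Delta>')" using s by simp
  moreover have "x \<notin> fnd \<Delta>' - {x'}"
    using step_fn[OF Res(3)] fresh assms(2) by auto
  then have "\<Delta> = nud x (substd \<Delta>' x x')" using Res nud_alpha by simp
  moreover have "substd \<Delta>' x x' = rend ?f \<Delta>'"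
    unfolding substd_rend using \<open>x \<notin> fnd \<Delta>' - {x'}\<close>
    by (intro rend_cong) (auto simp: Transposition.transpose_def)
  ultimately show ?thesis using that by simp
qed (use assms(2) in \<open>auto simp: nu_def inp_def\<close>)

subsection \<open>Termination\<close>

primrec prefix_count :: "state \<Rightarrow> nat" and prefix_countp :: "proc \<Rightarrow> nat" where
  "prefix_count Zero = 0"
| "prefix_count (DInp a P) = Suc (prefix_countp P)"
| "prefix_count (Outp a x P) = Suc (prefix_countp P)"
| "prefix_count (Match x y s) = prefix_count s"
| "prefix_count (Mismatch x y s) = prefix_count s"
| "prefix_count (Sum s t) = prefix_count s + prefix_count t"
| "prefix_count (Par s t) = prefix_count s + prefix_count t"
| "prefix_count (DRes s) = prefix_count s"
| "prefix_countp (St s) = prefix_count s"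
| "prefix_countp (Choice P p Q) = prefix_countp P + prefix_countp Q"

lemma prefix_count_ren [simp]: "prefix_count (ren f s) = prefix_count s"
  and prefix_countp_renp [simp]: "prefix_countp (renp f P) = prefix_countp P"
  by (induction s and P arbitrary: f and f) auto

lemma prefix_count_nu [simp]: "prefix_count (nu x s) = prefix_count s"
  by (simp add: nu_def)

lemma prefix_count_interp: "s \<in> set_pmf (interp P) \<Longrightarrow> prefix_count s \<le> prefix_countp P"
  by (induction P rule: proc.induct[where ?P1.0 = "\<lambda>_. True"])
     (fastforce split: if_splits)+

text \<open>Every transition consumes a prefix and no rule copies one, so computations terminate.
  Adding up both branches of \<open>Sum\<close> and \<open>Choice\<close> overestimates, which is
  harmless.\<close>

lemma step_prefix_count: "step s \<alpha> \<Delta> \<Longrightarrow> s' \<in> set_pmf \<Delta> \<Longrightarrow> prefix_count s' < prefix_count s"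
proof (induction arbitrary: s' rule: step.induct)
  case (Inp a x P)
  then show ?case using prefix_count_interp[of s' P] by (simp add: inp_def)
next
  case (Outp a x P)
  then show ?case using prefix_count_interp[of s' P] by simp
qed (fastforce simp: set_pard nud_def substd_def subst_def)+

subsection \<open>The testing name\<close>

lemma test_at_fresh: "w \<notin> fn s \<Longrightarrow> test_at w s" and testp_at_fresh: "w \<notin> fnp P \<Longrightarrow> testp_at w P"
  by (induction s and P arbitrary: w and w) auto

text \<open>No other name is sent to the image of \<open>w\<close>, so the renaming creates no new
  occurrence of it.\<close>

lemma test_at_ren: "(\<And>k. f k = f w \<Longrightarrow> k = w) \<Longrightarrow> test_at (f w) (ren f s) \<longleftrightarrow> test_at w s"
  and testp_at_ren: "(\<And>k. f k = f w \<Longrightarrow> k = w) \<Longrightarrow> testp_at (f w) (renp f P) \<longleftrightarrow> testp_at w P"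
proof (induction s and P arbitrary: f w and f w)
  case (DInp a P)
  have "testp_at (up f (Suc w)) (renp (up f) P) \<longleftrightarrow> testp_at (Suc w) P"
    by (rule DInp.IH) (use DInp.prems in \<open>auto simp: up_def split: nat.splits\<close>)
  then show ?case using DInp.prems by auto
next
  case (DRes s)
  have "test_at (up f (Suc w)) (ren (up f) s) \<longleftrightarrow> test_at (Suc w) s"
    by (rule DRes.IH) (use DRes.prems in \<open>auto simp: up_def split: nat.splits\<close>)
  then show ?case by simp
qed (simp_all, blast+)

lemma test_at_nu: "x \<noteq> w \<Longrightarrow> test_at w (nu x s) \<longleftrightarrow> test_at w s"
proof -
  assume x: "x \<noteq> w"
  have "test_at (bnd x w) (ren (bnd x) s) \<longleftrightarrow> test_at w s"
    by (rule test_at_ren) (use x in \<open>auto simp: bnd_def split: if_splits\<close>)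
  then show ?thesis using x by (simp add: nu_def bnd_def)
qed

lemma test_at_inp: "x \<noteq> w \<Longrightarrow> test_at w (inp a x P) \<longleftrightarrow> a \<noteq> w \<and> testp_at w P"
proof -
  assume x: "x \<noteq> w"
  have "testp_at (bnd x w) (renp (bnd x) P) \<longleftrightarrow> testp_at w P"
    by (rule testp_at_ren) (use x in \<open>auto simp: bnd_def split: if_splits\<close>)
  then show ?thesis using x by (simp add: inp_def bnd_def)
qed

text \<open>If \<open>x = w\<close>, the substitution erases \<open>w\<close> and nothing is
  required of \<open>s\<close>. This covers residuals whose bound name happens to be
  \<open>w\<close>.\<close>

lemma test_at_subst:
  assumes "y \<noteq> w" "x = w \<or> test_at w s"
  shows "test_at w (subst s y x)"
proof (cases "x = w")
  case True
  then show ?thesis using assms(1) by (auto simp: subst_def fn_ren intro!: test_at_fresh)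
next
  case False
  have "test_at ((id(x := y)) w) (ren (id(x := y)) s) \<longleftrightarrow> test_at w s"
    by (rule test_at_ren) (use assms(1) False in \<open>auto split: if_splits\<close>)
  then show ?thesis using assms(2) False by (simp add: subst_def)
qed

lemma test_at_interp: "testp_at w P \<Longrightarrow> s \<in> set_pmf (interp P) \<Longrightarrow> test_at w s"
  by (induction P rule: proc.induct[where ?P1.0 = "\<lambda>_. True"]) (auto split: if_splits)

lemma test_at_step_In:
  assumes "step s \<alpha> \<Delta>" "\<alpha> = In a x" "test_at w s" shows "a \<noteq> w"
  using assms
proof (induction rule: step.induct)
  case (Res s \<alpha> \<Delta> z)
  then show ?case by (cases "z = w") (auto simp: test_at_nu)
qed (auto simp: inp_def)

text \<open>The object \<open>w\<close> is allowed only on the channel \<open>w\<close>; this is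
  what keeps \<open>omega\<close> from reaching the tested process.\<close>

lemma test_at_step_Out:
  assumes "step s \<alpha> \<Delta>" "\<alpha> = Out a b" "a \<noteq> w" "test_at w s" shows "b \<noteq> w"
  using assms
proof (induction rule: step.induct)
  case (Res s \<alpha> \<Delta> z)
  then show ?case by (cases "z = w") (auto simp: test_at_nu)
qed auto

text \<open>The critical case is communication inside the test: the receiver's channel differs from
  \<open>w\<close>, hence so does the object sent, and the substitution does not introduce
  \<open>w\<close>.\<close>

lemma test_at_step:
  assumes "step s \<alpha> \<Delta>" "test_at w s" "w \<notin> bn \<alpha>" "s' \<in> set_pmf \<Delta>"
  shows "test_at w s'"
  using assms
proof (induction arbitrary: s' rule: step.induct)
  case (Inp a x P)
  then show ?case by (auto simp: test_at_inp intro: test_at_interp)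
next
  case (Outp a x P)
  then show ?case by (auto intro: test_at_interp)
next
  case (ComL s a x \<Delta>1 t y \<Delta>2)
  have "a \<noteq> w" using test_at_step_In[OF ComL.hyps(1) refl] ComL.prems(1) by simp
  then have "y \<noteq> w" using test_at_step_Out[OF ComL.hyps(2) refl] ComL.prems(1) by simp
  then have "test_at w (subst u y x)" if "u \<in> set_pmf \<Delta>1" for u
    using ComL.IH(1)[OF _ _ that] ComL.prems(1) by (intro test_at_subst) auto
  moreover have "test_at w u" if "u \<in> set_pmf \<Delta>2" for u
    using ComL.IH(2)[OF _ _ that] ComL.prems(1) by auto
  ultimately show ?case
    using ComL.prems(3) by (auto simp: set_pard substd_def)
next
  case (ComR s a x \<Delta>1 t y \<Delta>2)
  have "a \<noteq> w" using test_at_step_In[OF ComR.hyps(1) refl] ComR.prems(1) by simp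
  then have "y \<noteq> w" using test_at_step_Out[OF ComR.hyps(2) refl] ComR.prems(1) by simp
  then have "test_at w (subst u y x)" if "u \<in> set_pmf \<Delta>1" for u
    using ComR.IH(1)[OF _ _ that] ComR.prems(1) by (intro test_at_subst) auto
  moreover have "test_at w u" if "u \<in> set_pmf \<Delta>2" for u
    using ComR.IH(2)[OF _ _ that] ComR.prems(1) by auto
  ultimately show ?case
    using ComR.prems(3) by (auto simp: set_pard substd_def)
next
  case (CloseL s a x \<Delta>1 t \<Delta>2)
  show ?case
  proof (cases "x = w")
    \<comment> \<open>A restriction on \<open>w\<close> itself leaves no free occurrence of
      \<open>w\<close>.\<close>
    case True
    then show ?thesis using CloseL.prems(3) by (auto simp: nud_def fn_nu intro!: test_at_fresh)
  next
    case False
    have "test_at w u" if "u \<in> set_pmf \<Delta>1" for u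
      using CloseL.IH(1)[OF _ _ that] CloseL.prems(1) False by auto
    moreover have "test_at w u" if "u \<in> set_pmf \<Delta>2" for u
      using CloseL.IH(2)[OF _ _ that] CloseL.prems(1) False by auto
    ultimately show ?thesis
      using False CloseL.prems(3) by (auto simp: set_pard nud_def test_at_nu)
  qed
next
  case (CloseR s a x \<Delta>1 t \<Delta>2)
  show ?case
  proof (cases "x = w")
    case True
    then show ?thesis using CloseR.prems(3) by (auto simp: nud_def fn_nu intro!: test_at_fresh)
  next
    case False
    have "test_at w u" if "u \<in> set_pmf \<Delta>1" for u
      using CloseR.IH(1)[OF _ _ that] CloseR.prems(1) False by auto
    moreover have "test_at w u" if "u \<in> set_pmf \<Delta>2" for u
      using CloseR.IH(2)[OF _ _ that] CloseR.prems(1) False by auto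
    ultimately show ?thesis
      using False CloseR.prems(3) by (auto simp: set_pard nud_def test_at_nu)
  qed
next
  case (Res s \<alpha> \<Delta> z)
  show ?case
  proof (cases "z = w")
    case True
    then show ?thesis using Res.prems(3) by (auto simp: nud_def fn_nu intro!: test_at_fresh)
  next
    case False
    then show ?thesis using Res by (auto simp: nud_def test_at_nu)
  qed
next
  case (Open s a z \<Delta> y)
  have "z = w \<or> test_at w u" if "u \<in> set_pmf \<Delta>" for u
    using Open.IH[OF _ _ that] Open.prems(1) test_at_nu[of z w s] by auto
  then have "test_at w (subst u y z)" if "u \<in> set_pmf \<Delta>" for u
    using that Open.prems(2) by (intro test_at_subst) auto
  then show ?case using Open.prems(3) by (auto simp: substd_def)
qed (auto simp: set_pard)

subsection \<open>Outcomes of open systems\<close>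

definition succ :: "state \<Rightarrow> bool" where
  "succ s \<longleftrightarrow> (\<exists>\<Delta>. step s (Out omega omega) \<Delta>)"

text \<open>All names but \<open>omega\<close> being restricted in a test application, success there amounts to
  \<open>succ\<close>. Counting only this kind of success makes outcomes insensitive to restrictions, which
  can then be dropped.\<close>

inductive result :: "state \<Rightarrow> real \<Rightarrow> bool" where
  result_succ: "succ s \<Longrightarrow> result s 1"
| result_tau: "\<not> succ s \<Longrightarrow> step s Tau \<Delta> \<Longrightarrow> (\<And>t. t \<in> set_pmf \<Delta> \<Longrightarrow> result t (f t)) \<Longrightarrow>
    result s (measure_pmf.expectation \<Delta> f)"
| result_dead: "\<not> succ s \<Longrightarrow> \<not> (\<exists>\<Delta>. step s Tau \<Delta>) \<Longrightarrow> result s 0"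

definition resultd :: "state pmf \<Rightarrow> real \<Rightarrow> bool" where
  "resultd \<Delta> r \<longleftrightarrow>
     (\<exists>f. (\<forall>s\<in>set_pmf \<Delta>. result s (f s)) \<and> r = measure_pmf.expectation \<Delta> f)"

lemma expectation_finite:
  fixes f :: "'a \<Rightarrow> real"
  assumes "finite (set_pmf \<Delta>)"
  shows "measure_pmf.expectation \<Delta> f = (\<Sum>s\<in>set_pmf \<Delta>. pmf \<Delta> s * f s)"
  using assms by (subst integral_measure_pmf_real[of "set_pmf \<Delta>"]) (auto simp: mult.commute)

lemma expectation_cong:
  "(\<And>s. s \<in> set_pmf \<Delta> \<Longrightarrow> f s = g s) \<Longrightarrow>
    measure_pmf.expectation \<Delta> f = measure_pmf.expectation \<Delta> g" for f g :: "'a \<Rightarrow> real"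
  by (intro integral_cong_AE) (auto simp: AE_measure_pmf_iff)

lemma expectation_mono:
  "finite (set_pmf \<Delta>) \<Longrightarrow> (\<And>s. s \<in> set_pmf \<Delta> \<Longrightarrow> f s \<le> g s) \<Longrightarrow>
    measure_pmf.expectation \<Delta> f \<le> measure_pmf.expectation \<Delta> g" for f g :: "'a \<Rightarrow> real"
  by (simp add: expectation_finite sum_mono mult_left_mono)

lemma expectation_bind:
  "finite (set_pmf p) \<Longrightarrow> (\<And>i. i \<in> set_pmf p \<Longrightarrow> finite (set_pmf (\<Delta> i))) \<Longrightarrow>
    measure_pmf.expectation (bind_pmf p \<Delta>) f =
    measure_pmf.expectation p (\<lambda>i. measure_pmf.expectation (\<Delta> i) f)" for f :: "'a \<Rightarrow> real"
  by (subst pmf_expectation_bind[of "set_pmf p"]) (auto simp: expectation_finite)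

lemma success_closed: "fn s \<subseteq> {omega} \<Longrightarrow> success s \<longleftrightarrow> succ s"
  unfolding success_def succ_def using step_Out_fn by blast

text \<open>With no free name but \<open>omega\<close>, any output on \<open>omega\<close> has
  object \<open>omega\<close>, so the two notions of success agree; internal steps add no free
  names, so this persists along the computation.\<close>

lemma outcome_closed:
  assumes "fn s \<subseteq> {omega}"
  shows "outcome s r \<longleftrightarrow> result s r"
proof
  have closed: "fn t \<subseteq> {omega}" if "step s Tau \<Delta>" "t \<in> set_pmf \<Delta>" "fn s \<subseteq> {omega}" for s \<Delta> t
    using step_fn[OF that(1)] that(2,3) by (auto simp: fnd_def)
  show "result s r" if "outcome s r" using that assms
  proof (induction rule: outcome.induct)
    case (2 s \<Delta> f)
    have "result s (measure_pmf.expectation \<Delta> f)"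
      using 2 closed success_closed by (intro result_tau) auto
    then show ?case using step_finite[OF 2(2)] by (simp add: expectation_finite)
  qed (auto simp: success_closed intro: result.intros)
  show "outcome s r" if "result s r" using that assms
  proof (induction rule: result.induct)
    case (result_tau s \<Delta> f)
    have "outcome s (\<Sum>t\<in>set_pmf \<Delta>. pmf \<Delta> t * f t)"
      using result_tau closed success_closed by (intro outcome.intros(2)) auto
    then show ?case using step_finite[OF result_tau(2)] by (simp add: expectation_finite)
  qed (auto simp: success_closed intro: outcome.intros)
qed

section \<open>Restrictions do not affect results\<close>

lemma succ_nu: "w \<noteq> omega \<Longrightarrow> succ (nu w s) \<longleftrightarrow> succ s"
  unfolding succ_def
proof (intro iffI; elim exE)
  assume w: "w \<noteq> omega"
  show "\<exists>\<Delta>. step s (Out omega omega) \<Delta>" if "step (nu w s) (Out omega omega) \<Delta>" for \<Delta>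
    using step_nu_cases[OF that] w by auto
  show "\<exists>\<Delta>. step (nu w s) (Out omega omega) \<Delta>" if "step s (Out omega omega) \<Delta>" for \<Delta>
    using step.Res[OF that, of w] w by auto
qed

lemma step_nu_Tau: "step (nu w s) Tau \<Delta> \<longleftrightarrow> (\<exists>\<Delta>'. step s Tau \<Delta>' \<and> \<Delta> = nud w \<Delta>')"
  by (auto intro: step.Res[of _ "Tau"] elim!: step_nu_cases[of w s "Tau"])

text \<open>Internal steps of \<open>nu w s\<close> are those of \<open>s\<close> under the
  restriction, and the successful output does not mention \<open>w\<close>.\<close>

lemma result_nu:
  assumes w: "w \<noteq> omega"
  shows "result (nu w s) r \<longleftrightarrow> result s r"
proof
  show "result s r" if "result (nu w s) r" using that
  proof (induction "nu w s" r arbitrary: s rule: result.induct)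
    case (result_tau \<Delta> f)
    then obtain \<Delta>' where \<Delta>': "step s Tau \<Delta>'" "\<Delta> = nud w \<Delta>'" by (auto simp: step_nu_Tau)
    have "result s (measure_pmf.expectation \<Delta>' (\<lambda>t. f (nu w t)))"
      using result_tau \<Delta>' w by (intro result.result_tau) (auto simp: succ_nu nud_def)
    then show ?case by (simp add: \<Delta>' nud_def)
  qed (use w in \<open>auto simp: succ_nu step_nu_Tau intro: result.intros\<close>)
  show "result (nu w s) r" if "result s r" using that
  proof (induction rule: result.induct)
    case (result_tau s \<Delta> f)
    \<comment> \<open>Injectivity of \<open>nu w\<close> moves the values chosen for the residuals
      of \<open>s\<close> to their restrictions.\<close>
    define g where "g = f \<circ> inv (nu w)"
    have g: "g (nu w t) = f t" for t
      unfolding g_def by (simp add: inv_f_f inj_def nu_inject)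
    have "result (nu w s) (measure_pmf.expectation (nud w \<Delta>) g)"
      using result_tau w by (intro result.result_tau) (auto simp: succ_nu nud_def g step_nu_Tau)
    then show ?case by (simp add: nud_def g)
  qed (use w in \<open>auto simp: succ_nu step_nu_Tau intro: result.intros\<close>)
qed

lemma resultd_nud:
  assumes w: "w \<noteq> omega"
  shows "resultd (nud w \<Delta>) r \<longleftrightarrow> resultd \<Delta> r"
proof
  assume "resultd (nud w \<Delta>) r"
  then obtain f where "\<forall>s\<in>set_pmf (nud w \<Delta>). result s (f s)"
    "r = measure_pmf.expectation (nud w \<Delta>) f" by (auto simp: resultd_def)
  then show "resultd \<Delta> r" using w
    by (auto simp: resultd_def nud_def result_nu comp_def intro!: exI[of _ "f \<circ> nu w"])
next
  assume "resultd \<Delta> r"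
  then obtain f where "\<forall>s\<in>set_pmf \<Delta>. result s (f s)"
    "r = measure_pmf.expectation \<Delta> f" by (auto simp: resultd_def)
  then show "resultd (nud w \<Delta>) r" using w
    by (auto simp: resultd_def nud_def result_nu comp_def inv_f_f inj_def nu_inject
        intro!: exI[of _ "f \<circ> inv (nu w)"])
qed

lemma resultd_foldr_nud:
  "omega \<notin> set xs \<Longrightarrow> resultd (foldr nud xs \<Delta>) r \<longleftrightarrow> resultd \<Delta> r"
  by (induction xs arbitrary: r) (auto simp: resultd_nud)

lemma fnd_foldr_nud: "fnd (foldr nud xs \<Delta>) = fnd \<Delta> - set xs"
  by (induction xs) (auto simp: fnd_nud)

lemma finite_foldr_nud: "finite (set_pmf \<Delta>) \<Longrightarrow> finite (set_pmf (foldr nud xs \<Delta>))"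
  by (induction xs) (auto simp: nud_def)

text \<open>The restrictions are first used to pass from outcomes to results and then dropped, so
  that only the open system remains to be studied.\<close>

lemma test_apply_eq: "test_apply T P = {r. resultd (pard (interp T) (interp P)) r}"
proof -
  define xs where "xs = sorted_list_of_set ((fnp T \<union> fnp P) - {omega})"
  define \<Delta> where "\<Delta> = foldr nud xs (pard (interp T) (interp P))"
  have xs: "set xs = (fnp T \<union> fnp P) - {omega}" by (simp add: xs_def)
  have "fnd \<Delta> \<subseteq> {omega}"
    using fnd_interp[of T] fnd_interp[of P] by (auto simp: \<Delta>_def fnd_foldr_nud fnd_pard xs)
  then have "fn s \<subseteq> {omega}" if "s \<in> set_pmf \<Delta>" for s
    using that by (auto simp: fnd_def)
  moreover have "finite (set_pmf \<Delta>)"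
    unfolding \<Delta>_def by (intro finite_foldr_nud) (simp add: set_pard)
  ultimately have "outcomesd \<Delta> = {r. resultd \<Delta> r}"
    by (auto simp: outcomesd_def outcomes_def resultd_def outcome_closed expectation_finite)
  moreover have "test_apply T P = outcomesd \<Delta>" by (simp add: test_apply_def \<Delta>_def xs_def)
  moreover have "resultd \<Delta> r \<longleftrightarrow> resultd (pard (interp T) (interp P)) r" for r
    unfolding \<Delta>_def by (rule resultd_foldr_nud) (simp add: xs)
  ultimately show ?thesis by simp
qed

lemma result_exists: "\<exists>r. result s r"
proof (induction "prefix_count s" arbitrary: s rule: less_induct)
  case less
  show ?case
  proof (cases "succ s \<or> \<not> (\<exists>\<Delta>. step s Tau \<Delta>)")
    case True
    then show ?thesis using result_succ result_dead by blast
  next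
    case False
    then obtain \<Delta> where \<Delta>: "step s Tau \<Delta>" by blast
    have "\<forall>t\<in>set_pmf \<Delta>. \<exists>r. result t r" using less step_prefix_count[OF \<Delta>] by blast
    then obtain f where "\<forall>t\<in>set_pmf \<Delta>. result t (f t)" by metis
    then show ?thesis using \<Delta> False result_tau by blast
  qed
qed

lemma result_nonneg: "result s r \<Longrightarrow> 0 \<le> r"
  by (induction rule: result.induct) (auto intro!: integral_nonneg_AE simp: AE_measure_pmf_iff)

subsection \<open>Lifted relations\<close>

lemma lift_finite_left: "lift R \<Delta> \<Theta> \<Longrightarrow> finite (set_pmf \<Delta>)"
  by (induction rule: lift.induct) auto

lemma lift_finite_right:
  "lift R \<Delta> \<Theta> \<Longrightarrow> (\<And>s \<Theta>. R s \<Theta> \<Longrightarrow> finite (set_pmf \<Theta>)) \<Longrightarrow> finite (set_pmf \<Theta>)"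
  by (induction rule: lift.induct) auto

lemma fnd_bind: "fnd (bind_pmf p \<Delta>) = (\<Union>i\<in>set_pmf p. fnd (\<Delta> i))"
  by (auto simp: fnd_def)

lemma lift_fnd:
  "lift R \<Delta> \<Theta> \<Longrightarrow> (\<And>s \<Theta>. R s \<Theta> \<Longrightarrow> fnd \<Theta> \<subseteq> fn s \<union> B) \<Longrightarrow> fnd \<Theta> \<subseteq> fnd \<Delta> \<union> B"
proof (induction rule: lift.induct)
  case (convex p \<Delta> \<Theta>)
  then show ?case by (auto simp: fnd_bind)
qed (simp add: fnd_return)

text \<open>Carries a lifted relation into a context: \<open>g\<close> places each source state in
  it, and \<open>k\<close> does the same for the target states, possibly adding randomness of the
  context.\<close>

lemma lift_map_bind:
  assumes "lift R \<Delta> \<Theta>" and "\<And>s \<Theta>. R s \<Theta> \<Longrightarrow> R' (g s) (bind_pmf \<Theta> k)"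
  shows "lift R' (map_pmf g \<Delta>) (bind_pmf \<Theta> k)"
  using assms(1)
proof (induction rule: lift.induct)
  case (point s \<Theta>)
  then show ?case using assms(2) by (auto intro: lift.point)
next
  case (convex p \<Delta> \<Theta>)
  then have "lift R' (bind_pmf p (\<lambda>i. map_pmf g (\<Delta> i))) (bind_pmf p (\<lambda>i. bind_pmf (\<Theta> i) k))"
    by (intro lift.convex) auto
  then show ?case by (simp add: map_bind_pmf bind_assoc_pmf)
qed

text \<open>Lets each state of a finite support make its own move. The rule
  \<open>lift.convex\<close> takes indices in \<open>nat\<close>, so the support is numbered by
  \<open>h\<close> and decoded by \<open>h'\<close>.\<close>

lemma lift_pointwise:
  assumes fin: "finite (set_pmf \<Theta>)" and R: "\<And>s. s \<in> set_pmf \<Theta> \<Longrightarrow> R (g s) (k s)"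
  shows "lift R (map_pmf g \<Theta>) (bind_pmf \<Theta> k)"
proof -
  obtain h :: "'a \<Rightarrow> nat" where h: "inj_on h (set_pmf \<Theta>)"
    using finite_imp_inj_to_nat_seg[OF fin] by blast
  define h' where "h' = inv_into (set_pmf \<Theta>) h"
  have h': "h' (h s) = s" if "s \<in> set_pmf \<Theta>" for s
    using that h by (simp add: h'_def)
  have "lift R (bind_pmf (map_pmf h \<Theta>) (\<lambda>i. return_pmf (g (h' i))))
      (bind_pmf (map_pmf h \<Theta>) (\<lambda>i. k (h' i)))"
    using fin by (intro lift.convex) (auto simp: h' intro!: lift.point R)
  moreover have "bind_pmf (map_pmf h \<Theta>) (\<lambda>i. return_pmf (g (h' i))) = map_pmf g \<Theta>"
    unfolding bind_map_pmf map_pmf_def[of g] by (intro bind_pmf_cong) (auto simp: h')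
  moreover have "bind_pmf (map_pmf h \<Theta>) (\<lambda>i. k (h' i)) = bind_pmf \<Theta> k"
    unfolding bind_map_pmf by (intro bind_pmf_cong) (auto simp: h')
  ultimately show ?thesis by simp
qed

lemma tauhat_finite: "tauhat s \<Delta> \<Longrightarrow> finite (set_pmf \<Delta>)"
  by (auto simp: tauhat_def dest: step_finite)

lemma wtau_finite: "wtau \<Delta> \<Theta> \<Longrightarrow> finite (set_pmf \<Delta>) \<Longrightarrow> finite (set_pmf \<Theta>)"
  unfolding wtau_def
  by (induction rule: rtranclp_induct) (auto intro: lift_finite_right tauhat_finite)

lemma lift_tauhat_fnd: "lift tauhat \<Delta> \<Theta> \<Longrightarrow> fnd \<Theta> \<subseteq> fnd \<Delta>"
  using lift_fnd[of tauhat \<Delta> \<Theta> "{}"] step_fn by (fastforce simp: tauhat_def fnd_return)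

lemma wtau_fnd: "wtau \<Delta> \<Theta> \<Longrightarrow> fnd \<Theta> \<subseteq> fnd \<Delta>"
  unfolding wtau_def by (induction rule: rtranclp_induct) (auto dest: lift_tauhat_fnd)

lemma stepd_fnd: "stepd \<alpha> \<Delta> \<Theta> \<Longrightarrow> fnd \<Theta> \<subseteq> fnd \<Delta> \<union> bn \<alpha>"
  unfolding stepd_def by (erule lift_fnd) (rule step_fn)

lemma stepd_finite: "stepd \<alpha> \<Delta> \<Theta> \<Longrightarrow> finite (set_pmf \<Theta>)"
  unfolding stepd_def by (erule lift_finite_right) (rule step_finite)

subsection \<open>Attainable bounds\<close>

text \<open>The sign \<open>\<sigma>\<close> is \<open>1\<close> for may testing and \<open>-1\<close> for must testing.\<close>

definition attains :: "real \<Rightarrow> state pmf \<Rightarrow> real \<Rightarrow> bool" where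
  "attains \<sigma> \<Delta> r \<longleftrightarrow> (\<exists>r'. resultd \<Delta> r' \<and> \<sigma> * r \<le> \<sigma> * r')"

lemma attains_iff:
  "attains \<sigma> \<Delta> r \<longleftrightarrow>
    (\<exists>f. (\<forall>s\<in>set_pmf \<Delta>. result s (f s)) \<and> \<sigma> * r \<le> \<sigma> * measure_pmf.expectation \<Delta> f)"
  by (auto simp: attains_def resultd_def)

lemma attains_trans: "attains \<sigma> \<Delta> r' \<Longrightarrow> \<sigma> * r \<le> \<sigma> * r' \<Longrightarrow> attains \<sigma> \<Delta> r"
  by (auto simp: attains_def)

lemma attains_nud: "w \<noteq> omega \<Longrightarrow> attains \<sigma> (nud w \<Delta>) r \<longleftrightarrow> attains \<sigma> \<Delta> r"
  by (simp add: attains_def resultd_nud)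

lemma attains_return: "result s r \<Longrightarrow> attains \<sigma> (return_pmf s) r"
  by (auto simp: attains_iff)

text \<open>The sets of results are not convex, so a state in the support of several \<open>\<Delta> i\<close> gets the best of
  the values chosen there.\<close>

lemma attains_bind:
  assumes fin: "finite (set_pmf p)" "\<And>i. i \<in> set_pmf p \<Longrightarrow> finite (set_pmf (\<Delta> i))"
    and att: "\<And>i. i \<in> set_pmf p \<Longrightarrow> attains \<sigma> (\<Delta> i) (g i)"
  shows "attains \<sigma> (bind_pmf p \<Delta>) (measure_pmf.expectation p g)"
proof -
  have "\<forall>i\<in>set_pmf p. \<exists>f. (\<forall>s\<in>set_pmf (\<Delta> i). result s (f s)) \<and>
      \<sigma> * g i \<le> \<sigma> * measure_pmf.expectation (\<Delta> i) f"
    using att by (auto simp: attains_iff)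
  then obtain F where F: "\<And>i s. i \<in> set_pmf p \<Longrightarrow> s \<in> set_pmf (\<Delta> i) \<Longrightarrow> result s (F i s)"
    "\<And>i. i \<in> set_pmf p \<Longrightarrow> \<sigma> * g i \<le> \<sigma> * measure_pmf.expectation (\<Delta> i) (F i)"
    by metis
  have "\<forall>s\<in>set_pmf (bind_pmf p \<Delta>). \<exists>j\<in>set_pmf p. s \<in> set_pmf (\<Delta> j) \<and>
      (\<forall>i\<in>set_pmf p. s \<in> set_pmf (\<Delta> i) \<longrightarrow> \<sigma> * F i s \<le> \<sigma> * F j s)"
  proof
    fix s assume "s \<in> set_pmf (bind_pmf p \<Delta>)"
    then have "{i\<in>set_pmf p. s \<in> set_pmf (\<Delta> i)} \<noteq> {}" by auto
    moreover have "finite {i\<in>set_pmf p. s \<in> set_pmf (\<Delta> i)}" using fin(1) by simp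
    \<comment> \<open>Minimising the negated value picks the best choice for \<open>s\<close>: the
      largest for \<sigma> = 1, the smallest for \<sigma> = -1.\<close>
    ultimately obtain j
      where "is_arg_min (\<lambda>i. - (\<sigma> * F i s)) (\<lambda>i. i \<in> {i\<in>set_pmf p. s \<in> set_pmf (\<Delta> i)}) j"
      using ex_is_arg_min_if_finite[of "{i\<in>set_pmf p. s \<in> set_pmf (\<Delta> i)}"] by blast
    then show "\<exists>j\<in>set_pmf p. s \<in> set_pmf (\<Delta> j) \<and>
      (\<forall>i\<in>set_pmf p. s \<in> set_pmf (\<Delta> i) \<longrightarrow> \<sigma> * F i s \<le> \<sigma> * F j s)"
      by (auto simp: is_arg_min_linorder)
  qed
  then obtain j where j: "\<And>s. s \<in> set_pmf (bind_pmf p \<Delta>) \<Longrightarrow> j s \<in> set_pmf p \<and> s \<in> set_pmf (\<Delta> (j s))"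
    "\<And>s i. s \<in> set_pmf (bind_pmf p \<Delta>) \<Longrightarrow> i \<in> set_pmf p \<Longrightarrow> s \<in> set_pmf (\<Delta> i) \<Longrightarrow>
      \<sigma> * F i s \<le> \<sigma> * F (j s) s"
    by metis
  define h where "h s = F (j s) s" for s
  have "\<sigma> * measure_pmf.expectation p g = measure_pmf.expectation p (\<lambda>i. \<sigma> * g i)" by simp
  also have "\<dots> \<le> measure_pmf.expectation p (\<lambda>i. measure_pmf.expectation (\<Delta> i) (\<lambda>s. \<sigma> * h s))"
  proof (intro expectation_mono fin)
    fix i assume i: "i \<in> set_pmf p"
    have "\<sigma> * g i \<le> measure_pmf.expectation (\<Delta> i) (\<lambda>s. \<sigma> * F i s)" using F(2)[OF i] by simp
    also have "\<dots> \<le> measure_pmf.expectation (\<Delta> i) (\<lambda>s. \<sigma> * h s)"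
      using i j(2) by (intro expectation_mono fin) (auto simp: h_def)
    finally show "\<sigma> * g i \<le> measure_pmf.expectation (\<Delta> i) (\<lambda>s. \<sigma> * h s)" .
  qed
  also have "\<dots> = \<sigma> * measure_pmf.expectation (bind_pmf p \<Delta>) h"
    by (simp add: expectation_bind fin)
  finally show ?thesis
    unfolding attains_iff using F(1) j(1) by (intro exI[of _ h]) (auto simp: h_def)
qed

text \<open>Statewise bounds are averaged along the derivation of the lifting. The inclusion of
  supports hands properties of \<open>\<Theta>\<close>, such as freshness of \<open>omega\<close>,
  down to its components.\<close>

lemma attains_lift:
  assumes "lift R \<Delta> \<Theta>" and "finite (set_pmf \<Theta>)"
    and "\<And>s \<Theta>'. s \<in> set_pmf \<Delta> \<Longrightarrow> set_pmf \<Theta>' \<subseteq> set_pmf \<Theta> \<Longrightarrow> R s \<Theta>' \<Longrightarrow>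
      attains \<sigma> (map_pmf g \<Theta>') (f s)"
  shows "attains \<sigma> (map_pmf g \<Theta>) (measure_pmf.expectation \<Delta> f)"
  using assms
proof (induction rule: lift.induct)
  case (point s \<Theta>)
  then show ?case by simp
next
  case (convex p \<Delta> \<Theta>)
  have fin: "finite (set_pmf (\<Theta> i))" if "i \<in> set_pmf p" for i
    using convex.prems(1) that by (auto intro: finite_subset)
  have "attains \<sigma> (map_pmf g (\<Theta> i)) (measure_pmf.expectation (\<Delta> i) f)" if i: "i \<in> set_pmf p" for i
  proof (rule convex.IH[OF i fin[OF i]])
    fix s \<Theta>' assume "s \<in> set_pmf (\<Delta> i)" "set_pmf \<Theta>' \<subseteq> set_pmf (\<Theta> i)" "R s \<Theta>'"
    with i show "attains \<sigma> (map_pmf g \<Theta>') (f s)" by (intro convex.prems) auto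
  qed
  then have "attains \<sigma> (bind_pmf p (\<lambda>i. map_pmf g (\<Theta> i)))
      (measure_pmf.expectation p (\<lambda>i. measure_pmf.expectation (\<Delta> i) f))"
    using fin convex.hyps(1) by (intro attains_bind) auto
  moreover have "measure_pmf.expectation p (\<lambda>i. measure_pmf.expectation (\<Delta> i) f) =
      measure_pmf.expectation (bind_pmf p \<Delta>) f"
    using convex.hyps lift_finite_left by (intro expectation_bind[symmetric]) auto
  ultimately show ?case by (simp add: map_bind_pmf)
qed

text \<open>Bounds travel backwards along internal moves. A successful state has to be excluded,
  since its only result is 1 whatever its internal steps lead to.\<close>

lemma attains_lift_tauhat:
  assumes "lift tauhat \<Delta> \<Theta>" and "\<And>s. s \<in> set_pmf \<Delta> \<Longrightarrow> \<not> succ s" and "attains \<sigma> \<Theta> r"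
  shows "attains \<sigma> \<Delta> r"
proof -
  obtain f where f: "\<And>s. s \<in> set_pmf \<Theta> \<Longrightarrow> result s (f s)"
    and r: "\<sigma> * r \<le> \<sigma> * measure_pmf.expectation \<Theta> f"
    using assms(3) by (auto simp: attains_iff)
  \<comment> \<open>One function \<open>f\<close> is fixed before the induction, so that the
    expectations of the components add up to that of the combination.\<close>
  have "attains \<sigma> \<Delta> (measure_pmf.expectation \<Theta> f)"
    using assms(1,2) f
  proof (induction rule: lift.induct)
    case (point s \<Theta>)
    from point.hyps consider "step s Tau \<Theta>" | "\<Theta> = return_pmf s" by (auto simp: tauhat_def)
    then show ?case
    proof cases
      case 1
      then show ?thesis using point.prems by (intro attains_return result_tau) auto
    next
      case 2
      then show ?thesis using point.prems by (auto intro: attains_return)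
    qed
  next
    case (convex p \<Delta> \<Theta>)
    have "attains \<sigma> (bind_pmf p \<Delta>)
        (measure_pmf.expectation p (\<lambda>i. measure_pmf.expectation (\<Theta> i) f))"
    proof (rule attains_bind)
      fix i assume i: "i \<in> set_pmf p"
      show "finite (set_pmf (\<Delta> i))" using convex.hyps(2)[OF i] by (rule lift_finite_left)
      show "attains \<sigma> (\<Delta> i) (measure_pmf.expectation (\<Theta> i) f)"
        using i by (intro convex.IH convex.prems) auto
    qed (rule convex.hyps)
    moreover have "measure_pmf.expectation p (\<lambda>i. measure_pmf.expectation (\<Theta> i) f) =
        measure_pmf.expectation (bind_pmf p \<Theta>) f"
      using convex.hyps lift_finite_right tauhat_finite
      by (intro expectation_bind[symmetric]) blast+
    ultimately show ?case by simp
  qed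
  then show ?thesis using r by (rule attains_trans)
qed

subsection \<open>Parallel composition with a test\<close>

text \<open>A visible action of a composition comes from one component, and \<open>s\<close> cannot
  output on a name that is not free in it.\<close>

lemma succ_Par:
  assumes "omega \<notin> fn s"
  shows "succ (Par t s) \<longleftrightarrow> succ t"
proof
  assume "succ (Par t s)"
  then obtain \<Delta> where "step (Par t s) (Out omega omega) \<Delta>" by (auto simp: succ_def)
  then show "succ t"
  proof cases
    case (ParR \<Delta>')
    then show ?thesis using step_Out_fn[OF ParR(2) refl] assms by simp
  qed (auto simp: succ_def nu_def inp_def)
next
  assume "succ t"
  then obtain \<Delta> where "step t (Out omega omega) \<Delta>" by (auto simp: succ_def)
  then have "step (Par t s) (Out omega omega) (pard \<Delta> (return_pmf s))" by (intro step.ParL) auto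
  then show "succ (Par t s)" by (auto simp: succ_def)
qed

lemma succ_Par_fnd: "omega \<notin> fnd \<Theta> \<Longrightarrow> u \<in> set_pmf (map_pmf (Par t) \<Theta>) \<Longrightarrow> succ u \<longleftrightarrow> succ t"
  using succ_Par by (auto simp: fnd_def)

lemma attains_Par_succ:
  assumes "succ t" and "omega \<notin> fnd \<Theta>"
  shows "attains \<sigma> (map_pmf (Par t) \<Theta>) 1"
  unfolding attains_iff using succ_Par_fnd[OF assms(2)] assms(1)
  by (intro exI[of _ "\<lambda>_. 1"]) (auto intro: result_succ)

lemma attains_Par_succ_le:
  assumes "succ t" and "omega \<notin> fnd \<Theta>" and "attains \<sigma> (map_pmf (Par t) \<Theta>) r"
  shows "\<sigma> * r \<le> \<sigma> * 1"
proof -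
  obtain f where f: "\<And>u. u \<in> set_pmf (map_pmf (Par t) \<Theta>) \<Longrightarrow> result u (f u)"
    and r: "\<sigma> * r \<le> \<sigma> * measure_pmf.expectation (map_pmf (Par t) \<Theta>) f"
    using assms(3) by (auto simp: attains_iff simp del: integral_map_pmf)
  have "f u = 1" if "u \<in> set_pmf (map_pmf (Par t) \<Theta>)" for u
    using f[OF that] succ_Par_fnd[OF assms(2) that] assms(1) by (auto elim: result.cases)
  then have "measure_pmf.expectation (map_pmf (Par t) \<Theta>) f =
      measure_pmf.expectation (map_pmf (Par t) \<Theta>) (\<lambda>_. 1)"
    by (rule expectation_cong)
  then show ?thesis using r by simp
qed

lemma lift_tauhat_Par:
  assumes "lift tauhat \<Theta> \<Theta>'"
  shows "lift tauhat (map_pmf (Par t) \<Theta>) (map_pmf (Par t) \<Theta>')"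
  using assms unfolding map_pmf_def[of "Par t" \<Theta>']
proof (rule lift_map_bind)
  fix s \<Theta> assume "tauhat s \<Theta>"
  then show "tauhat (Par t s) (bind_pmf \<Theta> (\<lambda>x. return_pmf (Par t x)))"
    using step.ParR[of s Tau \<Theta> t]
    by (auto simp: tauhat_def pard_return_left map_pmf_def bind_return_pmf)
qed

text \<open>Success depends on \<open>t\<close> alone and is thus constant along the weak move:
  either 1 is the only result everywhere, or no state succeeds and bounds travel back step by
  step.\<close>

lemma attains_Par_wtau:
  assumes "wtau \<Theta> \<Theta>'" and "omega \<notin> fnd \<Theta>" and "attains \<sigma> (map_pmf (Par t) \<Theta>') r"
  shows "attains \<sigma> (map_pmf (Par t) \<Theta>) r"
proof (cases "succ t")
  case True
  have "omega \<notin> fnd \<Theta>'" using wtau_fnd[OF assms(1)] assms(2) by auto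
  then have "\<sigma> * r \<le> \<sigma> * 1" using attains_Par_succ_le True assms(3) by blast
  then show ?thesis using attains_Par_succ[OF True assms(2)] attains_trans by blast
next
  case False
  show ?thesis using assms unfolding wtau_def
  proof (induction rule: converse_rtranclp_induct)
    case (step \<Theta> \<Theta>1)
    have "omega \<notin> fnd \<Theta>1" using lift_tauhat_fnd[OF step(1)] step.prems by auto
    then show ?case
      using step succ_Par_fnd[OF step.prems(1), of _ t] False
      by (intro attains_lift_tauhat[OF lift_tauhat_Par[OF step(1)]]) auto
  qed
qed

text \<open>For fixed \<open>t\<close> the bound is averaged over the process component, then over
  \<open>t\<close>. The weak move to \<open>\<Theta>'\<close> is the same for all
  \<open>t\<close>.\<close>

lemma attains_pard:
  assumes fin: "finite (set_pmf \<Delta>1)" "finite (set_pmf \<Theta>)"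
    and wt: "wtau \<Theta> \<Theta>'" and li: "lift R \<Delta>2 \<Theta>'" and om: "omega \<notin> fnd \<Theta>"
    and att: "\<And>t s \<Theta>. t \<in> set_pmf \<Delta>1 \<Longrightarrow> s \<in> set_pmf \<Delta>2 \<Longrightarrow> R s \<Theta> \<Longrightarrow> omega \<notin> fnd \<Theta> \<Longrightarrow>
      attains \<sigma> (map_pmf (Par t) \<Theta>) (f (Par t s))"
  shows "attains \<sigma> (pard \<Delta>1 \<Theta>) (measure_pmf.expectation (pard \<Delta>1 \<Delta>2) f)"
proof -
  have fin2: "finite (set_pmf \<Delta>2)" using li by (rule lift_finite_left)
  have om': "omega \<notin> fnd \<Theta>'" using wtau_fnd[OF wt] om by auto
  have "attains \<sigma> (map_pmf (Par t) \<Theta>) (measure_pmf.expectation \<Delta>2 (\<lambda>s. f (Par t s)))"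
    if t: "t \<in> set_pmf \<Delta>1" for t
  proof (rule attains_Par_wtau[OF wt om], rule attains_lift[OF li wtau_finite[OF wt fin(2)]])
    fix s \<Theta>'' assume "s \<in> set_pmf \<Delta>2" "set_pmf \<Theta>'' \<subseteq> set_pmf \<Theta>'" "R s \<Theta>''"
    then show "attains \<sigma> (map_pmf (Par t) \<Theta>'') (f (Par t s))"
      using om' by (intro att t) (auto simp: fnd_def)
  qed
  then have "attains \<sigma> (pard \<Delta>1 \<Theta>)
      (measure_pmf.expectation \<Delta>1 (\<lambda>t. measure_pmf.expectation \<Delta>2 (\<lambda>s. f (Par t s))))"
    unfolding pard_bind using fin by (intro attains_bind) auto
  then show ?thesis unfolding pard_bind using fin fin2 by (simp add: expectation_bind)
qed

lemma Close_alpha: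
  assumes "fnd \<Delta>1 \<subseteq> insert x A" "fnd \<Delta>2 \<subseteq> insert x A" "w \<notin> A"
  shows "nud x (pard \<Delta>1 \<Delta>2) = nud w (pard (substd \<Delta>1 w x) (substd \<Delta>2 w x))"
  using assms nud_alpha[of w "pard \<Delta>1 \<Delta>2" x] by (auto simp: fnd_pard substd_rend rend_pard)

text \<open>Bound names of the synchronising actions can be kept out of any finite \<open>A\<close>,
  as the input clause of a simulation demands freshness for the simulating distribution as
  well.\<close>

lemma step_Par_Tau_cases [consumes 2, case_names Left Right InOut OutIn InBOut BOutIn]:
  assumes "step (Par t s) Tau \<Delta>" and "finite A"
  obtains
    (Left) \<Delta>1 where "step t Tau \<Delta>1" "\<Delta> = pard \<Delta>1 (return_pmf s)"
  | (Right) \<Delta>2 where "step s Tau \<Delta>2" "\<Delta> = pard (return_pmf t) \<Delta>2"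
  | (InOut) a b x \<Delta>1 \<Delta>2 where "step t (In a x) \<Delta>1" "step s (Out a b) \<Delta>2" "x \<notin> A"
      "\<Delta> = pard (substd \<Delta>1 b x) \<Delta>2"
  | (OutIn) a b x \<Delta>1 \<Delta>2 where "step t (Out a b) \<Delta>1" "step s (In a x) \<Delta>2" "x \<notin> A"
      "\<Delta> = pard \<Delta>1 (substd \<Delta>2 b x)"
  | (InBOut) a w \<Delta>1 \<Delta>2 where "step t (In a w) \<Delta>1" "step s (BOut a w) \<Delta>2" "w \<notin> A"
      "\<Delta> = nud w (pard \<Delta>1 \<Delta>2)"
  | (BOutIn) a w \<Delta>1 \<Delta>2 where "step t (BOut a w) \<Delta>1" "step s (In a w) \<Delta>2" "w \<notin> A"
      "\<Delta> = nud w (pard \<Delta>1 \<Delta>2)"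
proof -
  have fresh: "\<exists>w. w \<notin> A \<union> fn s \<union> fn t \<union> {a}" for a
    using ex_new_if_finite[OF infinite_UNIV_nat, of "A \<union> fn s \<union> fn t \<union> {a}"] assms(2) by simp
  from assms(1) show thesis
  proof cases
    case (ParL \<Delta>1)
    then show thesis by (intro Left) auto
  next
    case (ParR \<Delta>2)
    then show thesis by (intro Right) auto
  next
    case (ComL a x \<Delta>1 b \<Delta>2)
    obtain w where w: "w \<notin> A \<union> fn s \<union> fn t \<union> {a}" using fresh by blast
    then have "step t (In a w) (substd \<Delta>1 w x)" using step_alpha_In ComL by simp
    moreover have "substd (substd \<Delta>1 w x) b w = substd \<Delta>1 b x"
      using step_fn[OF ComL(2)] w by (intro substd_substd[of _ _ "fn t"]) auto
    ultimately show thesis using InOut[of a w _ b \<Delta>2] ComL w by simp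
  next
    case (ComR a x \<Delta>2 b \<Delta>1)
    obtain w where w: "w \<notin> A \<union> fn s \<union> fn t \<union> {a}" using fresh by blast
    then have "step s (In a w) (substd \<Delta>2 w x)" using step_alpha_In ComR by simp
    moreover have "substd (substd \<Delta>2 w x) b w = substd \<Delta>2 b x"
      using step_fn[OF ComR(2)] w by (intro substd_substd[of _ _ "fn s"]) auto
    ultimately show thesis using OutIn[of a b \<Delta>1 w] ComR w by simp
  next
    case (CloseL a x \<Delta>1 \<Delta>2)
    obtain w where w: "w \<notin> A \<union> fn s \<union> fn t \<union> {a}" using fresh by blast
    then have "step t (In a w) (substd \<Delta>1 w x)" "step s (BOut a w) (substd \<Delta>2 w x)"
      using step_alpha_In step_alpha_BOut CloseL by simp_all
    moreover have "\<Delta> = nud w (pard (substd \<Delta>1 w x) (substd \<Delta>2 w x))"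
      unfolding CloseL(1) using step_fn[OF CloseL(2)] step_fn[OF CloseL(3)] w
      by (intro Close_alpha[where A = "fn s \<union> fn t"]) auto
    ultimately show thesis using InBOut w by simp
  next
    case (CloseR a x \<Delta>2 \<Delta>1)
    obtain w where w: "w \<notin> A \<union> fn s \<union> fn t \<union> {a}" using fresh by blast
    then have "step s (In a w) (substd \<Delta>2 w x)" "step t (BOut a w) (substd \<Delta>1 w x)"
      using step_alpha_In step_alpha_BOut CloseR by simp_all
    moreover have "\<Delta> = nud w (pard (substd \<Delta>1 w x) (substd \<Delta>2 w x))"
      unfolding CloseR(1) using step_fn[OF CloseR(2)] step_fn[OF CloseR(3)] w
      by (intro Close_alpha[where A = "fn s \<union> fn t"]) auto
    ultimately show thesis using BOutIn w by simp
  qed (auto simp: nu_def inp_def)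
qed

text \<open>A visible move of the process becomes internal once \<open>t\<close> answers it;
  \<open>k\<close> supplies the residual of \<open>t\<close>.\<close>

lemma lift_tauhat_stepd:
  assumes "stepd \<alpha> \<Theta> \<Theta>'"
    and "\<And>s \<Theta>'. step s \<alpha> \<Theta>' \<Longrightarrow> step (Par t s) Tau (bind_pmf \<Theta>' k)"
  shows "lift tauhat (map_pmf (Par t) \<Theta>) (bind_pmf \<Theta>' k)"
  using assms unfolding stepd_def by (elim lift_map_bind) (auto simp: tauhat_def)

text \<open>The last step may involve the test, so \<open>\<Theta>2\<close> is arbitrary; before it
  the test component is still the unsuccessful \<open>t\<close>.\<close>

lemma attains_Par_tau:
  assumes "\<not> succ t" and "omega \<notin> fnd \<Theta>" and "wtau \<Theta> \<Theta>1"
    and "lift tauhat (map_pmf (Par t) \<Theta>1) \<Theta>2" and "attains \<sigma> \<Theta>2 r"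
  shows "attains \<sigma> (map_pmf (Par t) \<Theta>) r"
proof (rule attains_Par_wtau[OF assms(3,2)], rule attains_lift_tauhat[OF assms(4) _ assms(5)])
  have "omega \<notin> fnd \<Theta>1" using wtau_fnd[OF assms(3)] assms(2) by auto
  then show "\<not> succ u" if "u \<in> set_pmf (map_pmf (Par t) \<Theta>1)" for u
    using succ_Par_fnd that assms(1) by blast
qed

section \<open>Simulation under a test\<close>

lemma simulationD:
  assumes "simulation R" "R s \<Theta>"
  shows "finite (set_pmf \<Theta>)"
    and "step s (In a x) \<Delta> \<Longrightarrow> x \<notin> fn s \<union> fnd \<Theta> \<Longrightarrow> \<exists>\<Theta>1 \<Theta>2 \<Theta>'. wtau \<Theta> \<Theta>1 \<and>
      stepd (In a x) \<Theta>1 \<Theta>2 \<and> wtau (substd \<Theta>2 w x) \<Theta>' \<and> lift R (substd \<Delta> w x) \<Theta>'"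
    and "step s Tau \<Delta> \<Longrightarrow> \<exists>\<Theta>'. wtau \<Theta> \<Theta>' \<and> lift R \<Delta> \<Theta>'"
    and "step s (Out a b) \<Delta> \<Longrightarrow> \<exists>\<Theta>1 \<Theta>2 \<Theta>'. wtau \<Theta> \<Theta>1 \<and>
      stepd (Out a b) \<Theta>1 \<Theta>2 \<and> wtau \<Theta>2 \<Theta>' \<and> lift R \<Delta> \<Theta>'"
    and "step s (BOut a b) \<Delta> \<Longrightarrow> \<exists>\<Theta>1 \<Theta>2 \<Theta>'. wtau \<Theta> \<Theta>1 \<and>
      stepd (BOut a b) \<Theta>1 \<Theta>2 \<and> wtau \<Theta>2 \<Theta>' \<and> lift R \<Delta> \<Theta>'"
proof -
  note sim = assms(1)[unfolded simulation_def, rule_format, OF assms(2)]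
  show "finite (set_pmf \<Theta>)" using sim by blast
  show "step s (In a x) \<Delta> \<Longrightarrow> x \<notin> fn s \<union> fnd \<Theta> \<Longrightarrow> \<exists>\<Theta>1 \<Theta>2 \<Theta>'. wtau \<Theta> \<Theta>1 \<and>
      stepd (In a x) \<Theta>1 \<Theta>2 \<and> wtau (substd \<Theta>2 w x) \<Theta>' \<and> lift R (substd \<Delta> w x) \<Theta>'"
    using sim by blast
  have out: "\<exists>\<Theta>'. wstep \<alpha> \<Theta> \<Theta>' \<and> lift R \<Delta> \<Theta>'" if "step s \<alpha> \<Delta>" "\<forall>a x. \<alpha> \<noteq> In a x" for \<alpha>
    using sim that by blast
  show "step s Tau \<Delta> \<Longrightarrow> \<exists>\<Theta>'. wtau \<Theta> \<Theta>' \<and> lift R \<Delta> \<Theta>'"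
    using out[of Tau] by (simp add: wstep_def)
  show "step s (Out a b) \<Delta> \<Longrightarrow> \<exists>\<Theta>1 \<Theta>2 \<Theta>'. wtau \<Theta> \<Theta>1 \<and>
      stepd (Out a b) \<Theta>1 \<Theta>2 \<and> wtau \<Theta>2 \<Theta>' \<and> lift R \<Delta> \<Theta>'"
    using out[of "Out a b"] by (simp add: wstep_def) blast
  show "step s (BOut a b) \<Delta> \<Longrightarrow> \<exists>\<Theta>1 \<Theta>2 \<Theta>'. wtau \<Theta> \<Theta>1 \<and>
      stepd (BOut a b) \<Theta>1 \<Theta>2 \<and> wtau \<Theta>2 \<Theta>' \<and> lift R \<Delta> \<Theta>'"
    using out[of "BOut a b"] by (simp add: wstep_def) blast
qed

text \<open>The hypothesis \<open>dead\<close> isolates the one point where may and must testing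
  differ; the matching of internal steps serves both signs.\<close>

lemma attains_simulation:
  assumes sim: "simulation R"
    and dead: "\<And>s \<Theta> t. R s \<Theta> \<Longrightarrow> omega \<notin> fnd \<Theta> \<Longrightarrow> \<not> succ t \<Longrightarrow>
      \<not> (\<exists>\<Delta>. step (Par t s) Tau \<Delta>) \<Longrightarrow> attains \<sigma> (map_pmf (Par t) \<Theta>) 0"
    and "R s \<Theta>" "omega \<notin> fn s" "omega \<notin> fnd \<Theta>" "test_at omega t" "result (Par t s) r"
  shows "attains \<sigma> (map_pmf (Par t) \<Theta>) r"
  using assms(3-)
proof (induction "prefix_count t + prefix_count s" arbitrary: t s \<Theta> r rule: less_induct)
  case less
  note R = less.prems(1) and om_s = less.prems(2) and om = less.prems(3) and t = less.prems(4)
  note D = simulationD[OF sim R]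
  \<comment> \<open>The induction hypotheses for all pairs of residual states are merged into one
    bound on distributions; each case below only supplies the residuals and the matching
    moves.\<close>
  have IH: "attains \<sigma> (pard \<Delta>1 \<Theta>2) (measure_pmf.expectation (pard \<Delta>1 \<Delta>2) f)"
    if "finite (set_pmf \<Delta>1)" "finite (set_pmf \<Theta>2)" "wtau \<Theta>2 \<Theta>'" "lift R \<Delta>2 \<Theta>'"
      "omega \<notin> fnd \<Delta>2" "omega \<notin> fnd \<Theta>2"
      "\<And>t'. t' \<in> set_pmf \<Delta>1 \<Longrightarrow> test_at omega t'"
      "\<And>t' s'. t' \<in> set_pmf \<Delta>1 \<Longrightarrow> s' \<in> set_pmf \<Delta>2 \<Longrightarrow>
        prefix_count t' + prefix_count s' < prefix_count t + prefix_count s"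
      "\<And>u. u \<in> set_pmf (pard \<Delta>1 \<Delta>2) \<Longrightarrow> result u (f u)"
    for \<Delta>1 \<Delta>2 \<Theta>2 \<Theta>' f
  proof (rule attains_pard[OF that(1-4,6)])
    fix t' s' \<Theta>'' assume "t' \<in> set_pmf \<Delta>1" "s' \<in> set_pmf \<Delta>2" "R s' \<Theta>''" "omega \<notin> fnd \<Theta>''"
    then show "attains \<sigma> (map_pmf (Par t') \<Theta>'') (f (Par t' s'))"
      using that(5) by (intro less.hyps that(7,8)) (auto simp: fnd_def set_pard intro!: that(9))
  qed
  from less.prems(5) show ?case
  proof cases
    case result_succ
    then show ?thesis using attains_Par_succ om succ_Par[OF om_s] by simp
  next
    case result_dead
    then show ?thesis using dead[OF R om] succ_Par[OF om_s] by simp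
  next
    case (result_tau \<Delta> f)
    have ns: "\<not> succ t" using result_tau(2) succ_Par[OF om_s] by simp
    \<comment> \<open>Freshness for \<open>s\<close> and \<open>\<Theta>\<close> enables the input
      clause; avoiding \<open>omega\<close> preserves the test condition and lets the restrictions
      created by \<open>Close\<close> be dropped.\<close>
    have "finite (fn s \<union> fnd \<Theta> \<union> {omega})" using D(1) finite_fnd by simp
    with result_tau(3) show ?thesis
    proof (cases rule: step_Par_Tau_cases)
      case (Left \<Delta>1)
      have "wtau \<Theta> \<Theta>" by (simp add: wtau_def)
      have "attains \<sigma> (pard \<Delta>1 \<Theta>) r"
        unfolding result_tau(1) Left(2)
        by (rule IH[OF step_finite[OF Left(1)] D(1) \<open>wtau \<Theta> \<Theta>\<close> lift.point[of R, OF R]])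
          (use om om_s t test_at_step[OF Left(1)] step_prefix_count[OF Left(1)] result_tau(4)
            in \<open>auto simp: Left(2) fnd_return\<close>)
      moreover have "lift tauhat (map_pmf (Par t) \<Theta>) (pard \<Delta>1 \<Theta>)"
        unfolding pard_bind_right using D(1)
        by (intro lift_pointwise)
          (use step.ParL[OF Left(1)] in \<open>auto simp: tauhat_def pard_return_right\<close>)
      ultimately show ?thesis using attains_Par_tau[OF ns om \<open>wtau \<Theta> \<Theta>\<close>] by blast
    next
      case (Right \<Delta>2)
      obtain \<Theta>' where \<Theta>': "wtau \<Theta> \<Theta>'" "lift R \<Delta>2 \<Theta>'" using D(3)[OF Right(1)] by blast
      have "attains \<sigma> (pard (return_pmf t) \<Theta>) r"
        unfolding result_tau(1) Right(2)
        by (rule IH[OF _ D(1) \<Theta>'])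
          (use om om_s t step_fn[OF Right(1)] step_prefix_count[OF Right(1)] result_tau(4)
            in \<open>auto simp: Right(2)\<close>)
      then show ?thesis by (simp add: pard_return_left)
    next
      case (InOut a b x \<Delta>1 \<Delta>2)
      obtain \<Theta>1 \<Theta>2 \<Theta>' where \<Theta>: "wtau \<Theta> \<Theta>1" "stepd (Out a b) \<Theta>1 \<Theta>2" "wtau \<Theta>2 \<Theta>'" "lift R \<Delta>2 \<Theta>'"
        using D(4)[OF InOut(2)] by blast
      have b: "b \<noteq> omega" using step_Out_fn[OF InOut(2) refl] om_s by auto
      have "test_at omega t'" if "t' \<in> set_pmf (substd \<Delta>1 b x)" for t'
        using that test_at_step[OF InOut(1) t] InOut(3) b by (auto simp: substd_def intro!: test_at_subst)
      moreover have "prefix_count t' < prefix_count t" if "t' \<in> set_pmf (substd \<Delta>1 b x)" for t'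
        using that step_prefix_count[OF InOut(1)] by (auto simp: substd_def subst_def)
      moreover have "omega \<notin> fnd \<Theta>2" using wtau_fnd[OF \<Theta>(1)] stepd_fnd[OF \<Theta>(2)] om by auto
      moreover have "omega \<notin> fnd \<Delta>2" using step_fn[OF InOut(2)] om_s by auto
      moreover have "finite (set_pmf (substd \<Delta>1 b x))"
        using step_finite[OF InOut(1)] by (simp add: substd_def)
      ultimately have "attains \<sigma> (pard (substd \<Delta>1 b x) \<Theta>2) r"
        unfolding result_tau(1) InOut(4)
        using step_prefix_count[OF InOut(2)] result_tau(4)
        by (intro IH[OF _ stepd_finite[OF \<Theta>(2)] \<Theta>(3,4)])
          (auto simp: InOut(4) intro: add_strict_mono)
      moreover have "lift tauhat (map_pmf (Par t) \<Theta>1) (pard (substd \<Delta>1 b x) \<Theta>2)"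
        unfolding pard_bind_right
        by (rule lift_tauhat_stepd[OF \<Theta>(2)])
          (use step.ComL[OF InOut(1)] in \<open>simp add: pard_bind_right\<close>)
      ultimately show ?thesis using attains_Par_tau[OF ns om \<Theta>(1)] by blast
    next
      case (OutIn a b x \<Delta>1 \<Delta>2)
      obtain \<Theta>1 \<Theta>2 \<Theta>' where \<Theta>: "wtau \<Theta> \<Theta>1" "stepd (In a x) \<Theta>1 \<Theta>2"
        "wtau (substd \<Theta>2 b x) \<Theta>'" "lift R (substd \<Delta>2 b x) \<Theta>'"
        using D(2)[OF OutIn(2)] OutIn(3) by blast
      \<comment> \<open>Here the test sends a free name to the process. The channel is free in
        \<open>s\<close>, hence not \<open>omega\<close>, so the test condition excludes
        \<open>omega\<close> as object.\<close>
      have "a \<noteq> omega" using step_In_fn[OF OutIn(2) refl] om_s by auto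
      then have b: "b \<noteq> omega" using test_at_step_Out[OF OutIn(1) refl] t by simp
      have "prefix_count s' < prefix_count s" if "s' \<in> set_pmf (substd \<Delta>2 b x)" for s'
        using that step_prefix_count[OF OutIn(2)] by (auto simp: substd_def subst_def)
      moreover have "omega \<notin> fnd (substd \<Theta>2 b x)"
        using wtau_fnd[OF \<Theta>(1)] stepd_fnd[OF \<Theta>(2)] om b OutIn(3)
        by (auto simp: fnd_substd split: if_splits)
      moreover have "omega \<notin> fnd (substd \<Delta>2 b x)"
        using step_fn[OF OutIn(2)] om_s b OutIn(3) by (auto simp: fnd_substd split: if_splits)
      moreover have "finite (set_pmf (substd \<Theta>2 b x))"
        using stepd_finite[OF \<Theta>(2)] by (simp add: substd_def)
      ultimately have "attains \<sigma> (pard \<Delta>1 (substd \<Theta>2 b x)) r"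
        unfolding result_tau(1) OutIn(4)
        using step_prefix_count[OF OutIn(1)] result_tau(4) test_at_step[OF OutIn(1) t]
        by (intro IH[OF step_finite[OF OutIn(1)] _ \<Theta>(3,4)])
          (auto simp: OutIn(4) intro: add_strict_mono)
      moreover have "lift tauhat (map_pmf (Par t) \<Theta>1) (pard \<Delta>1 (substd \<Theta>2 b x))"
        unfolding pard_bind_right substd_def bind_map_pmf
        by (rule lift_tauhat_stepd[OF \<Theta>(2)])
          (use step.ComR[OF _ OutIn(1)] in \<open>simp add: pard_bind_right substd_def bind_map_pmf\<close>)
      ultimately show ?thesis using attains_Par_tau[OF ns om \<Theta>(1)] by blast
    next
      case (InBOut a w \<Delta>1 \<Delta>2)
      obtain \<Theta>1 \<Theta>2 \<Theta>' where \<Theta>: "wtau \<Theta> \<Theta>1" "stepd (BOut a w) \<Theta>1 \<Theta>2" "wtau \<Theta>2 \<Theta>'" "lift R \<Delta>2 \<Theta>'"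
        using D(5)[OF InBOut(2)] by blast
      have w: "w \<noteq> omega" using InBOut(3) by simp
      have "omega \<notin> fnd \<Theta>2" using wtau_fnd[OF \<Theta>(1)] stepd_fnd[OF \<Theta>(2)] om w by auto
      \<comment> \<open>The values \<open>f\<close> belong to restricted residuals; since
        \<open>w\<close> is not \<open>omega\<close>, they are equally results of the
        bodies.\<close>
      moreover have res: "result u (f (nu w u))" if "u \<in> set_pmf (pard \<Delta>1 \<Delta>2)" for u
        using result_tau(4)[of "nu w u"] that w by (simp add: InBOut(4) nud_def result_nu)
      moreover have "omega \<notin> fnd \<Delta>2" using step_fn[OF InBOut(2)] om_s w by auto
      ultimately have "attains \<sigma> (pard \<Delta>1 \<Theta>2)
          (measure_pmf.expectation (pard \<Delta>1 \<Delta>2) (\<lambda>u. f (nu w u)))"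
        using step_prefix_count[OF InBOut(1)] step_prefix_count[OF InBOut(2)] res
          test_at_step[OF InBOut(1) t] w
        by (intro IH[OF step_finite[OF InBOut(1)] stepd_finite[OF \<Theta>(2)] \<Theta>(3,4)])
          (auto intro: add_strict_mono)
      then have "attains \<sigma> (nud w (pard \<Delta>1 \<Theta>2)) r"
        unfolding attains_nud[OF w] result_tau(1) InBOut(4) by (simp add: nud_def)
      moreover have "lift tauhat (map_pmf (Par t) \<Theta>1) (nud w (pard \<Delta>1 \<Theta>2))"
        unfolding pard_bind_right nud_def map_bind_pmf
        by (rule lift_tauhat_stepd[OF \<Theta>(2)])
          (use step.CloseL[OF InBOut(1)] in \<open>simp add: pard_bind_right nud_def map_bind_pmf\<close>)
      ultimately show ?thesis using attains_Par_tau[OF ns om \<Theta>(1)] by blast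
    next
      case (BOutIn a w \<Delta>1 \<Delta>2)
      \<comment> \<open>The input clause is instantiated with the bound name itself, which turns
        both substitutions into identities.\<close>
      obtain \<Theta>1 \<Theta>2 \<Theta>' where \<Theta>: "wtau \<Theta> \<Theta>1" "stepd (In a w) \<Theta>1 \<Theta>2" "wtau \<Theta>2 \<Theta>'" "lift R \<Delta>2 \<Theta>'"
        using D(2)[OF BOutIn(2), of w] BOutIn(3) by (auto simp: substd_same)
      have w: "w \<noteq> omega" using BOutIn(3) by simp
      have "omega \<notin> fnd \<Theta>2" using wtau_fnd[OF \<Theta>(1)] stepd_fnd[OF \<Theta>(2)] om w by auto
      moreover have res: "result u (f (nu w u))" if "u \<in> set_pmf (pard \<Delta>1 \<Delta>2)" for u
        using result_tau(4)[of "nu w u"] that w by (simp add: BOutIn(4) nud_def result_nu)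
      moreover have "omega \<notin> fnd \<Delta>2" using step_fn[OF BOutIn(2)] om_s w by auto
      ultimately have "attains \<sigma> (pard \<Delta>1 \<Theta>2)
          (measure_pmf.expectation (pard \<Delta>1 \<Delta>2) (\<lambda>u. f (nu w u)))"
        using step_prefix_count[OF BOutIn(1)] step_prefix_count[OF BOutIn(2)] res
          test_at_step[OF BOutIn(1) t] w
        by (intro IH[OF step_finite[OF BOutIn(1)] stepd_finite[OF \<Theta>(2)] \<Theta>(3,4)])
          (auto intro: add_strict_mono)
      then have "attains \<sigma> (nud w (pard \<Delta>1 \<Theta>2)) r"
        unfolding attains_nud[OF w] result_tau(1) BOutIn(4) by (simp add: nud_def)
      moreover have "lift tauhat (map_pmf (Par t) \<Theta>1) (nud w (pard \<Delta>1 \<Theta>2))"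
        unfolding pard_bind_right nud_def map_bind_pmf
        by (rule lift_tauhat_stepd[OF \<Theta>(2)])
          (use step.CloseR[OF _ BOutIn(1)] in \<open>simp add: pard_bind_right nud_def map_bind_pmf\<close>)
      ultimately show ?thesis using attains_Par_tau[OF ns om \<Theta>(1)] by blast
    qed
  qed
qed

section \<open>Deadlocked compositions\<close>

text \<open>Settles the deadlock case of may testing: results exist and are nonnegative, so any
  choice of them lies above 0.\<close>

lemma attains_zero: "attains 1 \<Delta> 0"
proof -
  obtain f where f: "\<And>s. result s (f s)" using result_exists by metis
  have "0 \<le> measure_pmf.expectation \<Delta> f" using result_nonneg[OF f] by simp
  then show ?thesis using f by (auto simp: attains_iff)
qed

text \<open>The channels on which a process could synchronise with \<open>t\<close>; this is the set
  to which the refusal clause is applied.\<close>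

definition copartners :: "state \<Rightarrow> chan set" where
  "copartners t = {Nm a | a. barb t (Co a)} \<union> {Co a | a. barb t (Nm a)}"

text \<open>Barbs record only channels, whereas \<open>Close\<close> needs a common bound name;
  alpha-conversion of both actions to a fresh \<open>w\<close> bridges the gap.\<close>

lemma refuses_copartners_iff:
  "\<not> (\<exists>\<Delta>. step (Par t s) Tau \<Delta>) \<longleftrightarrow> \<not> (\<exists>\<Delta>. step t Tau \<Delta>) \<and> refuses s (copartners t)"
proof
  assume "\<not> (\<exists>\<Delta>. step t Tau \<Delta>) \<and> refuses s (copartners t)"
  then have t: "\<not> (\<exists>\<Delta>. step t Tau \<Delta>)" and s: "\<not> (\<exists>\<Delta>. step s Tau \<Delta>)"
    and barb: "\<And>a. barb t (Co a) \<Longrightarrow> \<not> barb s (Nm a)" "\<And>a. barb t (Nm a) \<Longrightarrow> \<not> barb s (Co a)"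
    by (auto simp: refuses_def copartners_def simp del: barb.simps)
  show "\<not> (\<exists>\<Delta>. step (Par t s) Tau \<Delta>)"
  proof
    assume "\<exists>\<Delta>. step (Par t s) Tau \<Delta>"
    then obtain \<Delta> where "step (Par t s) Tau \<Delta>" ..
    then show False using finite.emptyI
      by (cases rule: step_Par_Tau_cases) (use t s barb in \<open>auto; blast\<close>)+
  qed
next
  assume no: "\<not> (\<exists>\<Delta>. step (Par t s) Tau \<Delta>)"
  have "\<not> step t Tau \<Delta>" "\<not> step s Tau \<Delta>" for \<Delta>
    using no step.ParL[of t Tau \<Delta> s] step.ParR[of s Tau \<Delta> t] by auto
  moreover have fresh: "\<exists>w. w \<notin> fn s \<union> fn t \<union> {a}" for a
    using ex_new_if_finite[OF infinite_UNIV_nat, of "fn s \<union> fn t \<union> {a}"] by simp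
  have "\<not> barb s (Nm a)" if "barb t (Co a)" for a
  proof
    assume "barb s (Nm a)"
    then obtain x \<Delta>2 where s: "step s (In a x) \<Delta>2" by auto
    obtain w where w: "w \<notin> fn s \<union> fn t \<union> {a}" using fresh by blast
    from that obtain y \<Delta>1 where "step t (Out a y) \<Delta>1 \<or> step t (BOut a y) \<Delta>1" by auto
    then show False
    proof
      assume "step t (Out a y) \<Delta>1"
      then show False using step.ComR[OF s] no by blast
    next
      assume "step t (BOut a y) \<Delta>1"
      then show False
        using step.CloseR[OF step_alpha_In[OF s] step_alpha_BOut, of w t y \<Delta>1] w no by blast
    qed
  qed
  moreover have "\<not> barb s (Co a)" if "barb t (Nm a)" for a
  proof
    from that obtain x \<Delta>1 where t: "step t (In a x) \<Delta>1" by auto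
    obtain w where w: "w \<notin> fn s \<union> fn t \<union> {a}" using fresh by blast
    assume "barb s (Co a)"
    then obtain y \<Delta>2 where "step s (Out a y) \<Delta>2 \<or> step s (BOut a y) \<Delta>2" by auto
    then show False
    proof
      assume "step s (Out a y) \<Delta>2"
      then show False using step.ComL[OF t] no by blast
    next
      assume "step s (BOut a y) \<Delta>2"
      then show False
        using step.CloseL[OF step_alpha_In[OF t] step_alpha_BOut, of w s y \<Delta>2] w no by blast
    qed
  qed
  ultimately show "\<not> (\<exists>\<Delta>. step t Tau \<Delta>) \<and> refuses s (copartners t)"
    by (auto simp: refuses_def copartners_def simp del: barb.simps)
qed

text \<open>The refusal of \<open>s\<close> reappears at some \<open>\<Theta>'\<close> reachable
  from \<open>\<Theta>\<close>. There every composition with \<open>t\<close> is deadlocked without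
  success and has result 0.\<close>

lemma attains_refusal:
  assumes "failure_simulation R" "R s \<Theta>" "omega \<notin> fnd \<Theta>" "\<not> succ t"
    and "\<not> (\<exists>\<Delta>. step (Par t s) Tau \<Delta>)"
  shows "attains \<sigma> (map_pmf (Par t) \<Theta>) 0"
proof -
  have s: "refuses s (copartners t)" and t: "\<not> (\<exists>\<Delta>. step t Tau \<Delta>)"
    using assms(5) refuses_copartners_iff by auto
  obtain \<Theta>' where \<Theta>': "wtau \<Theta> \<Theta>'" "refusesd \<Theta>' (copartners t)"
    using assms(1,2) s unfolding failure_simulation_def by blast
  have "omega \<notin> fnd \<Theta>'" using wtau_fnd[OF \<Theta>'(1)] assms(3) by auto
  then have "\<not> succ u" if "u \<in> set_pmf (map_pmf (Par t) \<Theta>')" for u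
    using succ_Par_fnd that assms(4) by blast
  moreover have "\<not> (\<exists>\<Delta>. step u Tau \<Delta>)" if "u \<in> set_pmf (map_pmf (Par t) \<Theta>')" for u
  proof -
    from that obtain s' where s': "s' \<in> set_pmf \<Theta>'" "u = Par t s'" by auto
    then show ?thesis using \<Theta>'(2) t by (simp only: refusesd_def refuses_copartners_iff) blast
  qed
  ultimately have "result u 0" if "u \<in> set_pmf (map_pmf (Par t) \<Theta>')" for u
    using that by (intro result_dead) blast+
  then have "attains \<sigma> (map_pmf (Par t) \<Theta>') 0"
    by (auto simp: attains_iff intro!: exI[of _ "\<lambda>_. 0"])
  then show ?thesis by (rule attains_Par_wtau[OF \<Theta>'(1) assms(3)])
qed

section \<open>From states to test applications\<close>

lemma attains_test_apply:
  assumes sim: "simulation R"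
    and dead: "\<And>s \<Theta> t. R s \<Theta> \<Longrightarrow> omega \<notin> fnd \<Theta> \<Longrightarrow> \<not> succ t \<Longrightarrow>
      \<not> (\<exists>\<Delta>. step (Par t s) Tau \<Delta>) \<Longrightarrow> attains \<sigma> (map_pmf (Par t) \<Theta>) 0"
    and \<Theta>: "wtau (interp Q) \<Theta>" "lift R (interp P) \<Theta>"
    and om: "omega \<notin> fnp P" "omega \<notin> fnp Q" and "is_test T" and "r \<in> test_apply T P"
  shows "\<exists>r'\<in>test_apply T Q. \<sigma> * r \<le> \<sigma> * r'"
proof -
  obtain f where f: "\<And>u. u \<in> set_pmf (pard (interp T) (interp P)) \<Longrightarrow> result u (f u)"
    and r: "r = measure_pmf.expectation (pard (interp T) (interp P)) f"
    using assms(8) by (auto simp: test_apply_eq resultd_def)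
  have om': "omega \<notin> fnd (interp P)" "omega \<notin> fnd (interp Q)"
    using fnd_interp[of P] fnd_interp[of Q] om by auto
  have "attains \<sigma> (pard (interp T) (interp Q)) r"
    unfolding r
  proof (rule attains_pard[OF _ _ \<Theta> om'(2)])
    fix t s \<Theta>'
    assume t: "t \<in> set_pmf (interp T)" and s: "s \<in> set_pmf (interp P)"
      and \<Theta>': "R s \<Theta>'" "omega \<notin> fnd \<Theta>'"
    have res: "result (Par t s) (f (Par t s))" using t s by (intro f) (auto simp: set_pard)
    have test: "test_at omega t" using assms(7) t by (simp add: is_test_def test_at_interp)
    have om_s: "omega \<notin> fn s" using om'(1) s by (auto simp: fnd_def)
    show "attains \<sigma> (map_pmf (Par t) \<Theta>') (f (Par t s))"
      by (rule attains_simulation[OF sim _ \<Theta>'(1) om_s \<Theta>'(2) test res]) (rule dead)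
  qed auto
  then show ?thesis by (auto simp: attains_def test_apply_eq)
qed

theorem theorem2:
  fixes P Q :: "proc"
  assumes "omega \<notin> fnp P" and "omega \<notin> fnp Q"
  shows "(preS P Q \<longrightarrow> pmay P Q) \<and> (preFS P Q \<longrightarrow> pmust P Q)"
proof (intro conjI impI)
  assume "preS P Q"
  then obtain \<Theta> where "wtau (interp Q) \<Theta>" "lift simS (interp P) \<Theta>" by (auto simp: preS_def)
  then show "pmay P Q"
    using attains_test_apply[OF simulation_simS attains_zero _ _ assms(1,2)]
    unfolding pmay_def leHo_def by fastforce
next
  assume "preFS P Q"
  then obtain \<Theta> where "wtau (interp P) \<Theta>" "lift simFS (interp Q) \<Theta>" by (auto simp: preFS_def)
  moreover have sim: "simulation simFS"
    using failure_simulation_simFS by (simp add: failure_simulation_def)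
  moreover note attains_refusal[OF failure_simulation_simFS]
  \<comment> \<open>In the must case \<open>P\<close> simulates \<open>Q\<close>, so the roles of
    the processes are exchanged, and the sign -1 reverses the order of the outcomes.\<close>
  ultimately have "\<exists>r'\<in>test_apply T P. - 1 * r \<le> - 1 * r'" if "is_test T" "r \<in> test_apply T Q" for T r
    using assms that by (intro attains_test_apply[where R = simFS])
  then show "pmust P Q" unfolding pmust_def leSm_def by simp
qed

end
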